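(* Let $1\le p<n$ and $k>0$. The space $S^+(p,n)\cong (V_{n,p}\times P_p)/O(p)$, endowed with the metric $$g_{(U,R^2)}\big((\Delta_1,D_1),(\Delta_2,D_2)\big)=\mathrm{Tr}(\Delta_1^T\Delta_2)+k\,\mathrm{Tr}(R^{-1}D_1R^{-2}D_2R^{-1}),$$ is a Riemannian manifold with horizontal space $$\mathcal H_{(U,R^2)}=\{(\Delta,D):\ \Delta=U_\perp B,\ B\in\mathbb R^{(n-p)\times p},\ D=RD_0R,\ D_0\in \mathrm{Sym}(p)\}.$$ Furthermore, the metric is invariant with respect to orthogonal transformations ($A\mapsto OAO^T$, $O\in O(n)$), scalings ($A\mapsto \mu^2A$, $\mu\in\mathbb R\setminus\{0\}$), and pseudoinversion ($A\mapsto A^\dagger$).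
   Context: $S^+(p,n)$ is the set of real symmetric positive semidefinite $n\times n$ matrices of rank $p$. $V_{n,p}=\{U\in\mathbb R^{n\times p}: U^TU=I_p\}$ is the Stiefel manifold, $P_p$ is the set of symmetric positive definite $p\times p$ matrices, $\mathrm{Sym}(p)$ is the space of symmetric $p\times p$ matrices, and $A^\dagger$ is the Moore–Penrose pseudoinverse. Every $A\in S^+(p,n)$ can be written $A=UR^2U^T$ with $U\in V_{n,p}$, $R\in P_p$. The pair $(U,R^2)\in V_{n,p}\times P_p$ is determined by $A$ up to the action $(U,R^2)\mapsto(UO,O^TR^2O)$ of $O\in O(p)$; this gives the identification $S^+(p,n)\cong(V_{n,p}\times P_p)/O(p)$. For $(U,R^2)\in V_{n,p}\times P_p$, $U_\perp\in V_{n,n-p}$ denotes a matrix with $U^TU_\perp=0$. The fiber through $(U,R^2)$ is its $O(p)$-orbit, and the vertical space is the tangent space to the fiber, $\mathcal V_{(U,R^2)}=\{(U\Omega,R^2\Omega-\Omega R^2):\Omega\in\mathbb R^{p\times p},\ \Omega^T=-\Omega\}$. A horizontal space is a subspace of $T_{(U,R^2)}(V_{n,p}\times P_p)$ complementary (not required to be orthogonal) to $\mathcal V_{(U,R^2)}$. Tangent vectors to the quotient at the class of $(U,R^2)$ are represented by elements of the horizontal space $\mathcal H_{(U,R^2)}$ via the differential of the quotient map, and the formula for $g$ is to be understood as an inner product on $T_AS^+(p,n)$, $A=UR^2U^T$, through this representation; being a Riemannian manifold includes that this inner product does not depend on the representative $(U,R^2)$ of $A$ chosen. *)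

theory Defs
  imports "HOL-Analysis.Analysis"
begin

text \<open>
  Smooth submanifolds of a Euclidean space. \<open>Ck_on\<close> is meant for open sets: \<open>f' x v\<close> is the
  directional derivative at \<open>x\<close> in direction \<open>v\<close>, so in finite dimension the recursion is
  the usual notion of being k times continuously differentiable.
\<close>

primrec Ck_on :: "nat \<Rightarrow> 'a::euclidean_space set \<Rightarrow> ('a \<Rightarrow> 'b::euclidean_space) \<Rightarrow> bool" where
  "Ck_on 0 S f \<longleftrightarrow> continuous_on S f"
| "Ck_on (Suc k) S f \<longleftrightarrow>
     (\<exists>f'. (\<forall>x\<in>S. (f has_derivative f' x) (at x)) \<and> (\<forall>v. Ck_on k S (\<lambda>x. f' x v)))"

text \<open>Smoothness on an arbitrary subset: existence of local smooth extensions to open sets.\<close>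

definition smooth_on :: "'a::euclidean_space set \<Rightarrow> ('a \<Rightarrow> 'b::euclidean_space) \<Rightarrow> bool" where
  "smooth_on M f \<longleftrightarrow>
     (\<forall>x\<in>M. \<exists>T F. open T \<and> x \<in> T \<and> (\<forall>k. Ck_on k T F) \<and> (\<forall>y\<in>M \<inter> T. F y = f y))"

text \<open>
  Slice charts. All charts use one model subspace \<open>E\<close>, whose dimension is that of \<open>M\<close>;
  since subspaces of equal dimension are related by a linear automorphism of the ambient space,
  this only says that the dimension of \<open>M\<close> is constant.
\<close>

definition embedded_submanifold :: "'a::euclidean_space set \<Rightarrow> bool" where
  "embedded_submanifold M \<longleftrightarrow>
     (\<exists>E. subspace E \<and>
       (\<forall>x\<in>M. \<exists>T T' \<phi> \<psi>. open T \<and> x \<in> T \<and> open T' \<and> homeomorphism T T' \<phi> \<psi> \<and>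
          smooth_on T \<phi> \<and> smooth_on T' (\<psi> :: 'a \<Rightarrow> 'a) \<and> \<phi> ` (M \<inter> T) = E \<inter> T'))"

definition smooth_curve_at :: "'a::euclidean_space set \<Rightarrow> 'a \<Rightarrow> (real \<Rightarrow> 'a) \<Rightarrow> bool" where
  "smooth_curve_at M x \<gamma> \<longleftrightarrow>
     \<gamma> 0 = x \<and> (\<exists>e>0. smooth_on {-e<..<e} \<gamma> \<and> \<gamma> ` {-e<..<e} \<subseteq> M)"

definition tangent_space :: "'a::euclidean_space set \<Rightarrow> 'a \<Rightarrow> 'a set" where
  "tangent_space M x =
     {v. \<exists>\<gamma>. smooth_curve_at M x \<gamma> \<and> (\<gamma> has_vector_derivative v) (at 0)}"

text \<open>
  The differential pushes velocities of curves in \<open>M\<close> forward. For smooth \<open>f\<close> and tangent \<open>v\<close>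
  the vector \<open>w\<close> is unique, by the chain rule for a local extension of \<open>f\<close>.
\<close>

definition differential ::
    "'a::euclidean_space set \<Rightarrow> ('a \<Rightarrow> 'b::euclidean_space) \<Rightarrow> 'a \<Rightarrow> 'a \<Rightarrow> 'b" where
  "differential M f x v =
     (THE w. \<exists>\<gamma>. smooth_curve_at M x \<gamma> \<and> (\<gamma> has_vector_derivative v) (at 0) \<and>
        ((f \<circ> \<gamma>) has_vector_derivative w) (at 0))"

definition surjective_submersion ::
    "'a::euclidean_space set \<Rightarrow> 'b::euclidean_space set \<Rightarrow> ('a \<Rightarrow> 'b) \<Rightarrow> bool" where
  "surjective_submersion M N f \<longleftrightarrow>
     smooth_on M f \<and> f ` M = N \<and>
     (\<forall>x\<in>M. differential M f x ` tangent_space M x = tangent_space N (f x))"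

text \<open>Only the values of \<open>G x\<close> on the tangent space at \<open>x\<close> matter.\<close>

definition riemannian_metric :: "'a::euclidean_space set \<Rightarrow> ('a \<Rightarrow> 'a \<Rightarrow> 'a \<Rightarrow> real) \<Rightarrow> bool" where
  "riemannian_metric M G \<longleftrightarrow>
     (\<forall>x\<in>M. \<forall>u\<in>tangent_space M x. \<forall>v\<in>tangent_space M x. G x u v = G x v u) \<and>
     (\<forall>x\<in>M. \<forall>u\<in>tangent_space M x. \<forall>v\<in>tangent_space M x. \<forall>w\<in>tangent_space M x.
        \<forall>a b. G x (a *\<^sub>R u + b *\<^sub>R v) w = a * G x u w + b * G x v w) \<and>
     (\<forall>x\<in>M. \<forall>u\<in>tangent_space M x. u \<noteq> 0 \<longrightarrow> G x u u > 0) \<and>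
     (\<forall>X Y. smooth_on M X \<and> smooth_on M Y \<and>
        (\<forall>x\<in>M. X x \<in> tangent_space M x \<and> Y x \<in> tangent_space M x) \<longrightarrow>
        smooth_on M (\<lambda>x. G x (X x) (Y x)))"

definition riemannian_manifold :: "'a::euclidean_space set \<Rightarrow> ('a \<Rightarrow> 'a \<Rightarrow> 'a \<Rightarrow> real) \<Rightarrow> bool" where
  "riemannian_manifold M G \<longleftrightarrow> embedded_submanifold M \<and> riemannian_metric M G"

definition metric_invariant ::
    "'a::euclidean_space set \<Rightarrow> ('a \<Rightarrow> 'a \<Rightarrow> 'a \<Rightarrow> real) \<Rightarrow> ('a \<Rightarrow> 'a) \<Rightarrow> bool" where
  "metric_invariant M G f \<longleftrightarrow>
     smooth_on M f \<and> f ` M \<subseteq> M \<and>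
     (\<forall>x\<in>M. \<forall>u\<in>tangent_space M x. \<forall>v\<in>tangent_space M x.
        G (f x) (differential M f x u) (differential M f x v) = G x u v)"

text \<open>
  A linear complement of the vertical space at \<open>x\<close>, where \<open>F\<close> is the fiber through \<open>x\<close>; no
  orthogonality is required.
\<close>

definition horizontal_space :: "'a::euclidean_space set \<Rightarrow> 'a set \<Rightarrow> 'a \<Rightarrow> 'a set \<Rightarrow> bool" where
  "horizontal_space M F x H \<longleftrightarrow>
     subspace H \<and> H \<subseteq> tangent_space M x \<and> H \<inter> tangent_space F x = {0} \<and>
     tangent_space M x = {h + v | h v. h \<in> H \<and> v \<in> tangent_space F x}"

text \<open>A matrix with \<open>n\<close> rows and \<open>p\<close> columns has type \<^typ>\<open>real ^ 'p ^ 'n\<close>.\<close>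

definition sym_mat :: "(real ^ 'm ^ 'm) set" where
  "sym_mat = {A. transpose A = A}"

definition spd :: "(real ^ 'm ^ 'm) set" where
  "spd = {A \<in> sym_mat. \<forall>x. x \<noteq> 0 \<longrightarrow> x \<bullet> (A *v x) > 0}"

definition spsd :: "nat \<Rightarrow> (real ^ 'n ^ 'n) set" where
  "spsd p = {A \<in> sym_mat. (\<forall>x. x \<bullet> (A *v x) \<ge> 0) \<and> rank A = p}"

definition stiefel :: "(real ^ 'p ^ 'n) set" where
  "stiefel = {U. transpose U ** U = mat 1}"

definition pseudoinverse :: "real ^ 'n ^ 'm \<Rightarrow> real ^ 'm ^ 'n" where
  "pseudoinverse A = (THE X. A ** X ** A = A \<and> X ** A ** X = X \<and>
     transpose (A ** X) = A ** X \<and> transpose (X ** A) = X ** A)"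

text \<open>
  The quotient projection of \<open>V(n,p) \<times> P(p)\<close> onto the positive semidefinite matrices of rank \<open>p\<close>,
  and the fibers as orbits of the orthogonal group. The second component of a point is the matrix
  written \<open>R\<^sup>2\<close> informally, with \<open>R\<close> its positive definite square root.
\<close>

definition quot_proj :: "(real ^ 'p ^ 'n) \<times> (real ^ 'p ^ 'p) \<Rightarrow> real ^ 'n ^ 'n" where
  "quot_proj = (\<lambda>(U, S). U ** S ** transpose U)"

definition orbit ::
    "(real ^ 'p ^ 'n) \<times> (real ^ 'p ^ 'p) \<Rightarrow> ((real ^ 'p ^ 'n) \<times> (real ^ 'p ^ 'p)) set" where
  "orbit = (\<lambda>(U, S). {(U ** Q, transpose Q ** S ** Q) | Q. orthogonal_matrix Q})"

text \<open>
  The horizontal space at \<open>(U, R\<^sup>2)\<close>, where the columns of \<open>W\<close> are an orthonormal basis of the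
  orthogonal complement of the column space of \<open>U\<close>, and the inner product on it.
\<close>

definition hor :: "real ^ 'q ^ 'n \<Rightarrow> real ^ 'p ^ 'p \<Rightarrow> ((real ^ 'p ^ 'n) \<times> (real ^ 'p ^ 'p)) set" where
  "hor W R = {(W ** B, R ** D\<^sub>0 ** R) | B D\<^sub>0. D\<^sub>0 \<in> sym_mat}"

definition hor_metric :: "real \<Rightarrow> real ^ 'p ^ 'p \<Rightarrow>
    (real ^ 'p ^ 'n) \<times> (real ^ 'p ^ 'p) \<Rightarrow> (real ^ 'p ^ 'n) \<times> (real ^ 'p ^ 'p) \<Rightarrow> real" where
  "hor_metric k R = (\<lambda>(\<Delta>\<^sub>1, D\<^sub>1) (\<Delta>\<^sub>2, D\<^sub>2).
     trace (transpose \<Delta>\<^sub>1 ** \<Delta>\<^sub>2) +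
     k * trace (matrix_inv R ** D\<^sub>1 ** matrix_inv (R ** R) ** D\<^sub>2 ** matrix_inv R))"

end

theory Submission
  imports Defs
begin

text \<open>
  Everything rests on two explicit formulas. For \<open>A = U S U\<^sup>T\<close> with \<open>U\<^sup>T U = 1\<close> and \<open>S\<close> positive
  definite, the pseudoinverse is \<open>X = U S\<^sup>-\<^sup>1 U\<^sup>T\<close> and \<open>A X = U U\<^sup>T\<close> is the projection onto the
  column space. The differential of the quotient map sends the horizontal vector \<open>(\<Delta>, D)\<close> with \<open>U\<^sup>T \<Delta> = 0\<close> to
  \<open>u = \<Delta> S U\<^sup>T + U D U\<^sup>T + U S \<Delta>\<^sup>T\<close>, from which \<open>D = U\<^sup>T u U\<close> and \<open>\<Delta> = (1 - A X) u U S\<^sup>-\<^sup>1\<close> are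
  recovered. Substituting this into the metric on horizontal vectors gives
  \<^emph>\<open>Tr(X u (1 - A X) v X) + k Tr(X u X v)\<close> (\<open>spsd_metric\<close>, \<open>spsd_metric_quot_push\<close>). This expression
  contains only \<open>A\<close>, \<open>u\<close> and \<open>v\<close>, so it does not depend on the representative \<open>(U, S)\<close>; what remains is
  to show that it is a Riemannian metric and that it has the three invariances.

  The manifold. Near \<open>A\<^sub>0 = U S\<^sub>0 U\<^sup>T\<close> the block \<open>U\<^sup>T A U\<close> stays definite, and a symmetric \<open>A\<close> with this
  property has rank \<open>p\<close> and is positive semidefinite exactly if \<open>A = A U (U\<^sup>T A U)\<^sup>-\<^sup>1 U\<^sup>T A\<close>
  (\<open>spsd_nystrom\<close>), that is, if its Schur complement is 0. Subtracting the Schur term therefore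
  flattens the set of these matrices (\<open>schur_shear_image_spsd\<close>). The same formula shows that the
  pseudoinverse is locally the restriction of a rational map (\<open>smooth_on_pseudoinverse\<close>), hence the
  metric is smooth.

  Tangent spaces are determined by differentiating the defining equations along curves and by
  writing down curves with a prescribed velocity: rational curves of orthogonal matrices
  (\<open>orthogonal_curve_exists\<close>) move the frames, lines move the definite factor. For the base, the block of
  a velocity that belongs to the complement of the column space vanishes, since
  the corresponding block of the curve is positive semidefinite and equals 0 at the base point
  (\<open>tangent_space_spsd\<close>).

  Positivity of the metric reduces to \<open>Tr(T D T D) > 0\<close> for \<open>T\<close> positive definite and \<open>D \<noteq> 0\<close>
  symmetric, which follows by writing \<open>T\<close> as a sum of rank-one matrices (\<open>trace_spd_form_pos\<close>).
  Conjugation and scaling are linear maps that commute with pseudoinversion up to a factor, and the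
  factors cancel. For pseudoinversion, differentiating identities such as \<open>X A X = X\<close> shows that the blocks of
  the velocity change only by multiplications with \<open>X\<close> and by signs, and these cancel as well because
  \<open>A\<close> and \<open>X\<close> exchange roles (\<open>differential_pseudoinverse_blocks\<close>).
\<close>

section \<open>Calculus of smooth maps\<close>

lemma Ck_on_subset: "Ck_on k T f \<Longrightarrow> S \<subseteq> T \<Longrightarrow> Ck_on k S f"
proof (induction k arbitrary: f)
  case 0
  then show ?case by (auto intro: continuous_on_subset)
next
  case (Suc k)
  then obtain f' where f': "\<forall>x\<in>T. (f has_derivative f' x) (at x)" "\<forall>v. Ck_on k T (\<lambda>x. f' x v)"
    by auto
  then have "\<forall>v. Ck_on k S (\<lambda>x. f' x v)" using Suc.IH Suc.prems(2) by blast
  with f'(1) Suc.prems(2) show ?case unfolding Ck_on.simps(2) by blast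
qed

lemma Ck_on_Suc_imp_Ck_on: "Ck_on (Suc k) S f \<Longrightarrow> Ck_on k S f"
proof (induction k arbitrary: f)
  case 0
  then show ?case
    by (auto intro: continuous_at_imp_continuous_on has_derivative_continuous)
next
  case (Suc k)
  from Suc.prems obtain f' where "\<forall>x\<in>S. (f has_derivative f' x) (at x)"
    and "\<forall>v. Ck_on (Suc k) S (\<lambda>x. f' x v)"
    by (subst (asm) Ck_on.simps(2)) blast
  with Suc.IH show ?case by (auto simp del: Ck_on.simps(2) intro!: Ck_on.simps(2)[THEN iffD2])
qed

text \<open>Openness keeps the values outside the set out of the derivative.\<close>

lemma Ck_on_cong:
  assumes "open S" "\<And>x. x \<in> S \<Longrightarrow> f x = g x" "Ck_on k S f"
  shows "Ck_on k S g"
proof (cases k)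
  case 0
  then show ?thesis using assms by (auto cong: continuous_on_cong)
next
  case (Suc j)
  then obtain f' where f': "\<forall>x\<in>S. (f has_derivative f' x) (at x)" "\<forall>v. Ck_on j S (\<lambda>x. f' x v)"
    using assms(3) by auto
  have "(g has_derivative f' x) (at x)" if "x \<in> S" for x
    using f'(1) that assms(1,2) has_derivative_transform_within_open by blast
  with f'(2) Suc show ?thesis by auto
qed

lemma Ck_on_const: "Ck_on k S (\<lambda>x. c :: 'b::euclidean_space)"
proof (induction k arbitrary: c)
  case 0
  then show ?case by simp
next
  case (Suc k)
  have "\<forall>x\<in>S. ((\<lambda>x. c) has_derivative (\<lambda>v. 0)) (at x)" by auto
  moreover have "\<forall>v. Ck_on k S (\<lambda>x. 0 :: 'b)" using Suc by blast
  ultimately show ?case unfolding Ck_on.simps(2)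
    by (intro exI[of _ "\<lambda>x v. 0"]) auto
qed

lemma Ck_on_linear:
  assumes "bounded_linear f"
  shows "Ck_on k S f"
proof (cases k)
  case 0
  then show ?thesis using assms by (simp add: linear_continuous_on)
next
  case (Suc j)
  have "\<forall>x\<in>S. (f has_derivative f) (at x)" using assms by (simp add: bounded_linear_imp_has_derivative)
  moreover have "\<forall>v. Ck_on j S (\<lambda>x. f v)" using Ck_on_const by blast
  ultimately show ?thesis unfolding Suc Ck_on.simps(2)
    by (intro exI[of _ "\<lambda>x. f"]) auto
qed

lemma Ck_on_add:
  assumes "Ck_on k S f" "Ck_on k S g"
  shows "Ck_on k S (\<lambda>x. f x + g x)"
  using assms
proof (induction k arbitrary: f g)
  case 0
  then show ?case by (auto intro: continuous_intros)
next
  case (Suc k)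
  then obtain f' g' where "\<forall>x\<in>S. (f has_derivative f' x) (at x)" "\<forall>v. Ck_on k S (\<lambda>x. f' x v)"
     "\<forall>x\<in>S. (g has_derivative g' x) (at x)" "\<forall>v. Ck_on k S (\<lambda>x. g' x v)"
    by auto
  then show ?case unfolding Ck_on.simps(2)
    by (intro exI[of _ "\<lambda>x v. f' x v + g' x v"]) (auto intro!: has_derivative_add Suc.IH)
qed

lemma Ck_on_bilinear:
  assumes h: "bounded_bilinear h" and "Ck_on k S f" "Ck_on k S g"
  shows "Ck_on k S (\<lambda>x. h (f x) (g x))"
  using assms(2,3)
proof (induction k arbitrary: f g)
  case 0
  then show ?case using bounded_bilinear.continuous_on[OF h] by auto
next
  case (Suc k)
  then obtain f' g' where *: "\<forall>x\<in>S. (f has_derivative f' x) (at x)" "\<forall>v. Ck_on k S (\<lambda>x. f' x v)"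
     "\<forall>x\<in>S. (g has_derivative g' x) (at x)" "\<forall>v. Ck_on k S (\<lambda>x. g' x v)"
    by auto
  have "Ck_on k S f" "Ck_on k S g" using Suc.prems Ck_on_Suc_imp_Ck_on by blast+
  with * show ?case unfolding Ck_on.simps(2)
    by (intro exI[of _ "\<lambda>x v. h (f x) (g' x v) + h (f' x v) (g x)"])
       (auto intro!: bounded_bilinear.FDERIV[OF h] Suc.IH Ck_on_add)
qed

lemma Ck_on_sum:
  assumes "\<And>i. i \<in> I \<Longrightarrow> Ck_on k S (f i)"
  shows "Ck_on k S (\<lambda>x. \<Sum>i\<in>I. f i x)"
  using assms by (induction I rule: infinite_finite_induct) (auto intro: Ck_on_const Ck_on_add)

lemma Ck_on_prod:
  fixes f :: "'i \<Rightarrow> 'a::euclidean_space \<Rightarrow> real"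
  assumes "\<And>i. i \<in> I \<Longrightarrow> Ck_on k S (f i)"
  shows "Ck_on k S (\<lambda>x. \<Prod>i\<in>I. f i x)"
  using assms by (induction I rule: infinite_finite_induct)
    (auto intro: Ck_on_const Ck_on_bilinear[OF bounded_bilinear_mult])

text \<open>
  Expanding the linear map \<open>g' (f x)\<close> in a basis turns the derivative of a composition into
  a finite sum of products of maps that are one degree less smooth.
\<close>

lemma Ck_on_compose:
  assumes "Ck_on k T g" "Ck_on k S f" "f ` S \<subseteq> T"
  shows "Ck_on k S (\<lambda>x. g (f x))"
  using assms
proof (induction k arbitrary: f g)
  case 0
  then show ?case by (auto intro: continuous_on_compose2)
next
  case (Suc k)
  then obtain f' g' where *: "\<forall>x\<in>S. (f has_derivative f' x) (at x)" "\<And>v. Ck_on k S (\<lambda>x. f' x v)"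
     "\<forall>x\<in>T. (g has_derivative g' x) (at x)" "\<And>v. Ck_on k T (\<lambda>x. g' x v)"
    by auto
  have "Ck_on k S f" using Suc.prems Ck_on_Suc_imp_Ck_on by blast
  then have "Ck_on k S (\<lambda>x. g' (f x) b)" for b
    using Suc.IH[OF *(4) _ Suc.prems(3)] by blast
  moreover have "Ck_on k S (\<lambda>x. f' x v \<bullet> b)" for v b
    using Ck_on_bilinear[OF bounded_bilinear_inner *(2) Ck_on_const] .
  ultimately have "Ck_on k S (\<lambda>x. \<Sum>b\<in>Basis. (f' x v \<bullet> b) *\<^sub>R g' (f x) b)" for v
    by (intro Ck_on_sum Ck_on_bilinear[OF bounded_bilinear_scaleR])
  moreover have "((\<lambda>x. g (f x)) has_derivative
      (\<lambda>v. \<Sum>b\<in>Basis. (f' x v \<bullet> b) *\<^sub>R g' (f x) b)) (at x)" if "x \<in> S" for x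
  proof -
    have "(g has_derivative g' (f x)) (at (f x))" using *(3) Suc.prems(3) that by auto
    then have lin: "linear (g' (f x))" and
      "((\<lambda>x. g (f x)) has_derivative (\<lambda>v. g' (f x) (f' x v))) (at x)"
      using *(1) that by (auto intro: has_derivative_linear has_derivative_compose)
    moreover have "g' (f x) (f' x v) = (\<Sum>b\<in>Basis. (f' x v \<bullet> b) *\<^sub>R g' (f x) b)" for v
      by (subst euclidean_representation[of "f' x v", symmetric])
         (simp only: linear_sum[OF lin] linear_scale[OF lin])
    ultimately show ?thesis by simp
  qed
  ultimately show ?case unfolding Ck_on.simps(2)
    by (intro exI[of _ "\<lambda>x v. \<Sum>b\<in>Basis. (f' x v \<bullet> b) *\<^sub>R g' (f x) b"]) auto
qed

lemma Ck_on_inverse: "Ck_on k (- {0}) (inverse :: real \<Rightarrow> real)"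
proof (induction k)
  case 0
  then show ?case by (auto intro!: continuous_intros)
next
  case (Suc k)
  have "Ck_on k (- {0}) (\<lambda>x :: real. inverse x * inverse x)"
    by (rule Ck_on_bilinear[OF bounded_bilinear_mult Suc Suc])
  then have "Ck_on k (- {0}) (\<lambda>x :: real. (-v) *\<^sub>R (inverse x * inverse x))" for v :: real
    by (rule Ck_on_bilinear[OF bounded_bilinear_scaleR Ck_on_const])
  moreover have "\<forall>x\<in>- {0}. (inverse has_derivative (\<lambda>v. (-v) *\<^sub>R (inverse x * inverse x))) (at x)"
    by (auto intro!: derivative_eq_intros)
  ultimately show ?case unfolding Ck_on.simps(2)
    by (intro exI[of _ "\<lambda>x v. (-v) *\<^sub>R (inverse x * inverse x)"]) blast
qed

lemma Ck_on_vec_components: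
  fixes f :: "'a::euclidean_space \<Rightarrow> 'b::euclidean_space ^ 'n"
  assumes "\<And>i. Ck_on k S (\<lambda>x. f x $ i)"
  shows "Ck_on k S f"
proof -
  have lin: "bounded_linear (axis i :: 'b \<Rightarrow> 'b ^ 'n)" for i
    by (auto intro!: linear_conv_bounded_linear[THEN iffD1] linearI simp: axis_def vec_eq_iff)
  have "Ck_on k S (\<lambda>x. axis i (f x $ i) :: 'b ^ 'n)" for i
    using Ck_on_compose[OF Ck_on_linear[OF lin, of k UNIV i] assms[of i]] by simp
  then have "Ck_on k S (\<lambda>x. \<Sum>i\<in>UNIV. axis i (f x $ i) :: 'b ^ 'n)"
    by (intro Ck_on_sum)
  moreover have "(\<Sum>i\<in>UNIV. axis i (f x $ i)) = f x" for x
    by (simp add: vec_eq_iff axis_def if_distrib cong: if_cong)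
  ultimately show ?thesis by simp
qed

lemma Ck_on_matrix_entries:
  fixes f :: "'a::euclidean_space \<Rightarrow> real ^ 'm ^ 'n"
  assumes "\<And>i j. Ck_on k S (\<lambda>x. f x $ i $ j)"
  shows "Ck_on k S f"
  using assms by (intro Ck_on_vec_components)

lemma bounded_linear_matrix_entry: "bounded_linear (\<lambda>A :: real ^ 'm ^ 'n. A $ i $ j)"
  by (intro bounded_linear_compose[OF bounded_linear_vec_nth bounded_linear_vec_nth])

lemma Ck_on_det:
  fixes f :: "'a::euclidean_space \<Rightarrow> real ^ 'n ^ 'n"
  assumes "Ck_on k S f"
  shows "Ck_on k S (\<lambda>x. det (f x))"
proof -
  have "Ck_on k S (\<lambda>x. f x $ i $ j)" for i j
    using Ck_on_compose[OF Ck_on_linear[OF bounded_linear_matrix_entry, of k UNIV i j] assms] by simp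
  then show ?thesis unfolding det_def
    by (intro Ck_on_sum Ck_on_bilinear[OF bounded_bilinear_mult] Ck_on_const Ck_on_prod)
qed

lemma matrix_inv_mult:
  assumes "invertible A"
  shows "A ** matrix_inv A = mat 1" "matrix_inv A ** A = mat 1"
  using assms unfolding invertible_def matrix_inv_def by (metis (mono_tags, lifting) someI_ex)+

text \<open>By Cramer's rule the entries of the inverse are quotients of determinants.\<close>

lemma Ck_on_matrix_inv: "Ck_on k {A :: real ^ 'n ^ 'n. invertible A} matrix_inv"
proof -
  let ?I = "{A :: real ^ 'n ^ 'n. invertible A}"
  have "continuous_on UNIV (det :: real ^ 'n ^ 'n \<Rightarrow> real)"
    using Ck_on_det[OF Ck_on_linear[OF bounded_linear_ident], of 0 UNIV] by simp
  then have op: "open ?I"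
    by (auto simp: invertible_det_nz intro: open_Collect_neq continuous_on_const)
  let ?B = "\<lambda>(A :: real ^ 'n ^ 'n) i j. (\<chi> a b. if b = i then axis j 1 $ a else A $ a $ b) :: real ^ 'n ^ 'n"
  have B: "Ck_on k ?I (\<lambda>A. ?B A i j)" for i j
  proof (rule Ck_on_matrix_entries)
    fix a b
    show "Ck_on k ?I (\<lambda>A. ?B A i j $ a $ b)"
      by (cases "b = i") (auto intro: Ck_on_const Ck_on_linear[OF bounded_linear_matrix_entry])
  qed
  have "Ck_on k ?I (\<lambda>A. inverse (det A))"
    by (rule Ck_on_compose[OF Ck_on_inverse Ck_on_det[OF Ck_on_linear[OF bounded_linear_ident]]])
       (auto simp: invertible_det_nz)
  then have q: "Ck_on k ?I (\<lambda>A. det (?B A i j) * inverse (det A))" for i j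
    by (intro Ck_on_bilinear[OF bounded_bilinear_mult] Ck_on_det B)
  have eq: "matrix_inv A $ i $ j = det (?B A i j) * inverse (det A)" if "A \<in> ?I" for A i j
  proof -
    have "A *v (matrix_inv A *v axis j 1) = axis j 1"
      using that by (simp add: matrix_vector_mul_assoc matrix_inv_mult)
    then have "matrix_inv A *v axis j 1 = (\<chi> i. det (?B A i j) / det A)"
      using cramer that by (auto simp: invertible_det_nz)
    moreover have "(matrix_inv A *v axis j 1) $ i = matrix_inv A $ i $ j"
      by (simp add: matrix_vector_mult_basis column_def)
    ultimately show ?thesis by (simp add: divide_inverse)
  qed
  show ?thesis
  proof (rule Ck_on_matrix_entries)
    show "Ck_on k ?I (\<lambda>A. matrix_inv A $ i $ j)" for i j
      by (rule Ck_on_cong[OF op _ q[of i j]]) (rule eq[symmetric])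
  qed
qed

lemma smooth_on_open:
  assumes "open S" "\<And>k. Ck_on k S f"
  shows "smooth_on S f"
  using assms unfolding smooth_on_def by blast

lemma smooth_on_bilinear:
  assumes "bounded_bilinear h" "smooth_on M f" "smooth_on M g"
  shows "smooth_on M (\<lambda>x. h (f x) (g x))"
  unfolding smooth_on_def
proof
  fix x assume "x \<in> M"
  obtain T F where 1: "open T" "x \<in> T" "\<forall>k. Ck_on k T F" "\<forall>y\<in>M \<inter> T. F y = f y"
    using assms(2) \<open>x \<in> M\<close> unfolding smooth_on_def by blast
  obtain T' F' where 2: "open T'" "x \<in> T'" "\<forall>k. Ck_on k T' F'" "\<forall>y\<in>M \<inter> T'. F' y = g y"
    using assms(3) \<open>x \<in> M\<close> unfolding smooth_on_def by blast
  have smooth: "Ck_on k (T \<inter> T') (\<lambda>y. h (F y) (F' y))" for k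
    using Ck_on_subset[OF spec[OF 1(3)]] Ck_on_subset[OF spec[OF 2(3)]] by (intro Ck_on_bilinear[OF assms(1)]) auto
  have nbhd: "open (T \<inter> T')" "x \<in> T \<inter> T'" using 1 2 by auto
  have ext: "\<forall>y\<in>M \<inter> (T \<inter> T'). h (F y) (F' y) = h (f y) (g y)"
    using 1(4) 2(4) by auto
  show "\<exists>T F. open T \<and> x \<in> T \<and> (\<forall>k. Ck_on k T F) \<and> (\<forall>y\<in>M \<inter> T. F y = h (f y) (g y))"
    by (rule exI[of _ "T \<inter> T'"], rule exI[of _ "\<lambda>y. h (F y) (F' y)"]) (intro conjI allI smooth nbhd ext)
qed

lemma smooth_on_add:
  assumes "smooth_on M f" "smooth_on M g"
  shows "smooth_on M (\<lambda>x. f x + g x)"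
  unfolding smooth_on_def
proof
  fix x assume "x \<in> M"
  obtain T F where 1: "open T" "x \<in> T" "\<forall>k. Ck_on k T F" "\<forall>y\<in>M \<inter> T. F y = f y"
    using assms(1) \<open>x \<in> M\<close> unfolding smooth_on_def by blast
  obtain T' F' where 2: "open T'" "x \<in> T'" "\<forall>k. Ck_on k T' F'" "\<forall>y\<in>M \<inter> T'. F' y = g y"
    using assms(2) \<open>x \<in> M\<close> unfolding smooth_on_def by blast
  have smooth: "Ck_on k (T \<inter> T') (\<lambda>y. F y + F' y)" for k
    using Ck_on_subset[OF spec[OF 1(3)]] Ck_on_subset[OF spec[OF 2(3)]] by (intro Ck_on_add) auto
  have nbhd: "open (T \<inter> T')" "x \<in> T \<inter> T'" using 1 2 by auto
  have ext: "\<forall>y\<in>M \<inter> (T \<inter> T'). F y + F' y = f y + g y"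
    using 1(4) 2(4) by auto
  show "\<exists>T F. open T \<and> x \<in> T \<and> (\<forall>k. Ck_on k T F) \<and> (\<forall>y\<in>M \<inter> T. F y = f y + g y)"
    by (rule exI[of _ "T \<inter> T'"], rule exI[of _ "\<lambda>y. F y + F' y"]) (intro conjI allI smooth nbhd ext)
qed

lemma smooth_on_linear: "bounded_linear f \<Longrightarrow> smooth_on M f"
  unfolding smooth_on_def
  by (rule ballI, rule exI[of _ UNIV], rule exI[of _ f]) (simp add: Ck_on_linear)

lemma smooth_on_const: "smooth_on M (\<lambda>x. c)"
  unfolding smooth_on_def
  by (rule ballI, rule exI[of _ UNIV], rule exI[of _ "\<lambda>x. c"]) (simp add: Ck_on_const)

lemma smooth_on_linear_compose:
  assumes "bounded_linear h" "smooth_on M f"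
  shows "smooth_on M (\<lambda>x. h (f x))"
  unfolding smooth_on_def
proof
  fix x assume "x \<in> M"
  then obtain T F where F: "open T" "x \<in> T" "\<forall>k. Ck_on k T F" "\<forall>y\<in>M \<inter> T. F y = f y"
    using assms(2) unfolding smooth_on_def by blast
  have smooth: "Ck_on k T (\<lambda>y. h (F y))" for k
    using Ck_on_compose[OF Ck_on_linear[OF assms(1), of k UNIV] spec[OF F(3)]] by simp
  have ext: "\<forall>y\<in>M \<inter> T. h (F y) = h (f y)" using F(4) by simp
  show "\<exists>T F. open T \<and> x \<in> T \<and> (\<forall>k. Ck_on k T F) \<and> (\<forall>y\<in>M \<inter> T. F y = h (f y))"
    by (rule exI[of _ T], rule exI[of _ "\<lambda>y. h (F y)"]) (intro conjI allI smooth F(1,2) ext)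
qed

lemma smooth_on_diff:
  assumes "smooth_on M f" "smooth_on M g"
  shows "smooth_on M (\<lambda>x. f x - g x)"
  using smooth_on_add[OF assms(1) smooth_on_linear_compose[OF bounded_linear_minus[OF bounded_linear_ident] assms(2)]]
  by simp

section \<open>Velocities of curves\<close>

lemma smooth_curve_at_eventually:
  assumes "smooth_curve_at M x \<gamma>"
  shows "\<gamma> 0 = x" "\<forall>\<^sub>F t in nhds 0. \<gamma> t \<in> M" "\<gamma> 0 \<in> M"
proof -
  from assms obtain e where "e > 0" "\<gamma> ` {-e<..<e} \<subseteq> M" "\<gamma> 0 = x"
    unfolding smooth_curve_at_def by blast
  then show "\<gamma> 0 = x" "\<gamma> 0 \<in> M" by force+
  from \<open>\<gamma> ` {-e<..<e} \<subseteq> M\<close> \<open>e > 0\<close> show "\<forall>\<^sub>F t in nhds 0. \<gamma> t \<in> M"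
    unfolding eventually_nhds by (intro exI[of _ "{-e<..<e}"]) auto
qed

lemma smooth_curve_atI:
  assumes "\<gamma> 0 = x" "open S" "0 \<in> S" "\<And>k. Ck_on k S \<gamma>" "\<gamma> ` S \<subseteq> M"
  shows "smooth_curve_at M x \<gamma>"
proof -
  obtain e where e: "e > 0" "ball 0 e \<subseteq> S" using assms(2,3) open_contains_ball by blast
  then have sub: "{-e<..<e} \<subseteq> S" by (auto simp: ball_def subset_iff dist_real_def abs_less_iff)
  have "smooth_on {-e<..<e} \<gamma>"
    by (rule smooth_on_open[OF open_greaterThanLessThan Ck_on_subset[OF assms(4) sub]])
  moreover have "\<gamma> ` {-e<..<e} \<subseteq> M" using sub assms(5) by blast
  ultimately show ?thesis using e(1) assms(1) unfolding smooth_curve_at_def by blast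
qed

lemma has_vector_derivative_eventually_cong:
  assumes "(f has_vector_derivative v) (at 0)" "\<forall>\<^sub>F t in nhds 0. f t = g t"
  shows "(g has_vector_derivative v) (at 0)"
  using assms has_vector_derivative_cong_ev[of UNIV f g 0 v] eventually_nhds_x_imp_x[OF assms(2)]
  by simp

lemma differential_eqI:
  assumes "v \<in> tangent_space M x"
    and "\<And>\<gamma>. smooth_curve_at M x \<gamma> \<Longrightarrow> (\<gamma> has_vector_derivative v) (at 0) \<Longrightarrow>
          ((f \<circ> \<gamma>) has_vector_derivative w) (at 0)"
  shows "differential M f x v = w"
  unfolding differential_def
proof (rule the_equality)
  show "\<exists>\<gamma>. smooth_curve_at M x \<gamma> \<and> (\<gamma> has_vector_derivative v) (at 0) \<and>
      (f \<circ> \<gamma> has_vector_derivative w) (at 0)"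
    using assms unfolding tangent_space_def by blast
  show "w' = w" if "\<exists>\<gamma>. smooth_curve_at M x \<gamma> \<and> (\<gamma> has_vector_derivative v) (at 0) \<and>
      (f \<circ> \<gamma> has_vector_derivative w') (at 0)" for w'
    using that assms(2) vector_derivative_unique_at by blast
qed

text \<open>
  By the chain rule for a local smooth extension, all curves with velocity \<open>v\<close> give the same
  velocity of \<open>f \<circ> \<gamma>\<close>; so the definite description in the differential is satisfied.
\<close>

lemma smooth_on_differential:
  assumes "smooth_on M f" "x \<in> M" "v \<in> tangent_space M x"
  shows "\<exists>\<gamma>. smooth_curve_at M x \<gamma> \<and> (\<gamma> has_vector_derivative v) (at 0) \<and>
     ((f \<circ> \<gamma>) has_vector_derivative differential M f x v) (at 0)"
proof -
  obtain T F where *: "open T" "x \<in> T" "\<forall>k. Ck_on k T F" "\<forall>y\<in>M \<inter> T. F y = f y"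
    using assms(1,2) unfolding smooth_on_def by blast
  from *(3) have "Ck_on (Suc 0) T F" by blast
  with *(2) obtain F' where F': "(F has_derivative F') (at x)" unfolding Ck_on.simps(2) by blast
  have d: "((f \<circ> \<gamma>) has_vector_derivative F' v) (at 0)"
    if c: "smooth_curve_at M x \<gamma>" and v: "(\<gamma> has_vector_derivative v) (at 0)" for \<gamma>
  proof -
    note sc = smooth_curve_at_eventually[OF c]
    have "((F \<circ> \<gamma>) has_derivative (\<lambda>t. F' (t *\<^sub>R v))) (at 0)"
      using v F' sc(1) unfolding has_vector_derivative_def o_def
      by (intro has_derivative_compose[of \<gamma> _ 0 UNIV F]) auto
    then have "((F \<circ> \<gamma>) has_vector_derivative F' v) (at 0)"
      using linear_scale[OF has_derivative_linear[OF F']] unfolding has_vector_derivative_def by simp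
    moreover have "isCont \<gamma> 0" using v by (rule has_vector_derivative_continuous)
    then have "(\<gamma> \<longlongrightarrow> \<gamma> 0) (nhds 0)"
      by (simp add: isCont_def tendsto_at_iff_tendsto_nhds)
    then have "\<forall>\<^sub>F t in nhds 0. \<gamma> t \<in> T"
      using topological_tendstoD[of \<gamma> "\<gamma> 0" "nhds 0" T] *(1,2) sc(1) by simp
    then have "\<forall>\<^sub>F t in nhds 0. (F \<circ> \<gamma>) t = (f \<circ> \<gamma>) t"
      using sc(2) by eventually_elim (use *(4) in auto)
    ultimately show ?thesis by (rule has_vector_derivative_eventually_cong)
  qed
  obtain \<gamma> where \<gamma>: "smooth_curve_at M x \<gamma>" "(\<gamma> has_vector_derivative v) (at 0)"
    using assms(3) unfolding tangent_space_def by blast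
  moreover have "differential M f x v = F' v" by (rule differential_eqI[OF assms(3) d])
  ultimately show ?thesis using d[OF \<gamma>] by metis
qed

section \<open>Matrix algebra\<close>

lemma bounded_bilinear_matrix_mult:
  "bounded_bilinear ((**) :: real ^ 'n ^ 'm \<Rightarrow> real ^ 'k ^ 'n \<Rightarrow> real ^ 'k ^ 'm)"
  unfolding bilinear_conv_bounded_bilinear[symmetric] bilinear_def
  by (auto intro!: linearI simp: matrix_matrix_mult_def vec_eq_iff algebra_simps sum.distrib sum_distrib_left)

interpretation matrix_mult: bounded_bilinear
  "(**) :: real ^ 'n ^ 'm \<Rightarrow> real ^ 'k ^ 'n \<Rightarrow> real ^ 'k ^ 'm"
  by (rule bounded_bilinear_matrix_mult)

lemma bounded_linear_transpose: "bounded_linear (transpose :: real ^ 'n ^ 'm \<Rightarrow> real ^ 'm ^ 'n)"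
  unfolding linear_conv_bounded_linear[symmetric]
  by (auto intro!: linearI simp: transpose_def vec_eq_iff)

lemmas transpose_linear =
  linear_add[OF bounded_linear.linear[OF bounded_linear_transpose]]
  linear_diff[OF bounded_linear.linear[OF bounded_linear_transpose]]
  linear_neg[OF bounded_linear.linear[OF bounded_linear_transpose]]
  linear_scale[OF bounded_linear.linear[OF bounded_linear_transpose]]
  linear_0[OF bounded_linear.linear[OF bounded_linear_transpose]]

lemma bounded_linear_trace: "bounded_linear (trace :: real ^ 'n ^ 'n \<Rightarrow> real)"
  unfolding linear_conv_bounded_linear[symmetric]
  by (auto intro!: linearI simp: trace_def sum.distrib sum_distrib_left)

lemmas trace_linear =
  linear_add[OF bounded_linear.linear[OF bounded_linear_trace]]
  linear_diff[OF bounded_linear.linear[OF bounded_linear_trace]]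
  linear_neg[OF bounded_linear.linear[OF bounded_linear_trace]]
  linear_scale[OF bounded_linear.linear[OF bounded_linear_trace]]
  linear_0[OF bounded_linear.linear[OF bounded_linear_trace]]

text \<open>
  Matrices of different shapes do not form a ring type, so \<open>algebra_simps\<close> does not reach
  products. These rules bring a matrix expression to a sum of right-nested products.
\<close>

lemmas matrix_simps =
  matrix_mult.add_left matrix_mult.add_right matrix_mult.diff_left matrix_mult.diff_right
  matrix_mult.minus_left matrix_mult.minus_right matrix_mult.scaleR_left matrix_mult.scaleR_right
  matrix_mult.zero_left matrix_mult.zero_right
  matrix_mul_assoc[symmetric] matrix_transpose_mul
  transpose_linear

text \<open>Lets a product rule fire inside a right-nested product.\<close>

lemma matrix_mult_cancel_left:
  fixes A :: "real ^ 'n ^ 'm"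
  shows "A ** B = C \<Longrightarrow> A ** (B ** X) = C ** X"
  by (simp add: matrix_mul_assoc)

lemma inner_transpose: "(transpose A *v x) \<bullet> y = x \<bullet> (A *v y)" for A :: "real ^ 'n ^ 'm"
  by (simp add: dot_lmul_matrix)

lemma symmetric_inner_commute:
  fixes A :: "real ^ 'n ^ 'n"
  assumes "transpose A = A"
  shows "x \<bullet> (A *v y) = y \<bullet> (A *v x)"
  using inner_transpose[of A x y] assms by (metis inner_commute)

lemma trace_transpose_mult_self_eq_0:
  fixes A :: "real ^ 'n ^ 'm"
  shows "trace (transpose A ** A) \<ge> 0" "trace (transpose A ** A) = 0 \<longleftrightarrow> A = 0"
proof -
  have eq: "trace (transpose A ** A) = (\<Sum>j\<in>UNIV. \<Sum>i\<in>UNIV. (A $ i $ j)\<^sup>2)"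
    by (simp add: trace_def matrix_matrix_mult_def transpose_def power2_eq_square)
  show "trace (transpose A ** A) \<ge> 0" unfolding eq by (simp add: sum_nonneg)
  show "trace (transpose A ** A) = 0 \<longleftrightarrow> A = 0"
    unfolding eq by (auto simp: sum_nonneg_eq_0_iff sum_nonneg vec_eq_iff)
qed

lemma invertibleI:
  fixes A :: "real ^ 'n ^ 'n"
  shows "A ** B = mat 1 \<Longrightarrow> invertible A"
  by (meson invertible_def matrix_left_right_inverse)

lemma matrix_inv_unique:
  fixes A :: "real ^ 'n ^ 'n"
  assumes "A ** B = mat 1"
  shows "matrix_inv A = B"
proof -
  have "matrix_inv A ** A = mat 1" using matrix_inv_mult(2) invertibleI assms by blast
  then show ?thesis using assms by (metis matrix_mul_assoc matrix_mul_lid matrix_mul_rid)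
qed

lemma transpose_matrix_inv:
  fixes A :: "real ^ 'n ^ 'n"
  assumes "invertible A"
  shows "transpose (matrix_inv A) = matrix_inv (transpose A)"
  using matrix_inv_mult(2)[OF assms]
  by (intro matrix_inv_unique[symmetric]) (metis matrix_transpose_mul transpose_mat)

subsection \<open>Positive matrices\<close>

definition posdef :: "(real ^ 'm ^ 'm) set" where
  "posdef = {A. \<forall>x. x \<noteq> 0 \<longrightarrow> x \<bullet> (A *v x) > 0}"

lemma spd_iff: "A \<in> spd \<longleftrightarrow> transpose A = A \<and> A \<in> posdef"
  by (simp add: spd_def sym_mat_def posdef_def)

lemma posdef_invertible: "A \<in> posdef \<Longrightarrow> invertible A"
  unfolding invertible_left_inverse matrix_left_invertible_ker
  by (fastforce simp: posdef_def)

text \<open>Only the compact unit sphere has to be tested, so failure is a closed condition.\<close>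

lemma open_posdef: "open (posdef :: (real ^ 'm ^ 'm) set)"
proof -
  have cont: "continuous_on UNIV (\<lambda>z :: (real ^ 'm) \<times> (real ^ 'm ^ 'm). fst z \<bullet> (snd z *v fst z))"
  proof -
    have "(\<lambda>z :: (real ^ 'm) \<times> (real ^ 'm ^ 'm). fst z \<bullet> (snd z *v fst z)) =
        (\<lambda>z. \<Sum>i\<in>UNIV. \<Sum>j\<in>UNIV. fst z $ i * (snd z $ i $ j * fst z $ j))"
      by (simp add: inner_vec_def matrix_vector_mult_def sum_distrib_left)
    then show ?thesis by (simp only:) (intro continuous_intros)
  qed
  let ?T = "{(x :: real ^ 'm, A :: real ^ 'm ^ 'm). x \<bullet> (A *v x) \<le> 0}"
  have T: "?T = {z. fst z \<bullet> (snd z *v fst z) \<le> 0}" by auto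
  have "closed ?T" unfolding T by (rule closed_Collect_le[OF cont continuous_on_const])
  then have "closed {A. \<exists>x :: real ^ 'm. x \<in> sphere 0 1 \<and> (x, A) \<in> ?T}"
    by (intro closed_compact_projection) simp
  moreover have "{A. \<exists>x :: real ^ 'm. x \<in> sphere 0 1 \<and> (x, A) \<in> ?T} = - posdef"
  proof (intro set_eqI iffI)
    fix A :: "real ^ 'm ^ 'm"
    assume "A \<in> {A. \<exists>x :: real ^ 'm. x \<in> sphere 0 1 \<and> (x, A) \<in> ?T}"
    then obtain x :: "real ^ 'm" where x: "norm x = 1" "x \<bullet> (A *v x) \<le> 0" by auto
    then have "x \<noteq> 0" by auto
    with x(2) show "A \<in> - posdef" by (auto simp: posdef_def not_less)
  next
    fix A :: "real ^ 'm ^ 'm"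
    assume "A \<in> - posdef"
    then obtain x where x: "x \<noteq> 0" "x \<bullet> (A *v x) \<le> 0" by (auto simp: posdef_def not_less)
    let ?y = "(1 / norm x) *\<^sub>R x"
    have "?y \<bullet> (A *v ?y) = (1 / norm x)\<^sup>2 * (x \<bullet> (A *v x))"
      by (simp add: matrix_vector_mult_scaleR power2_eq_square)
    also have "\<dots> \<le> 0" using x(2) by (simp add: mult_nonneg_nonpos)
    finally have "?y \<in> sphere 0 1 \<and> (?y, A) \<in> ?T" using x(1) by simp
    then show "A \<in> {A. \<exists>x :: real ^ 'm. x \<in> sphere 0 1 \<and> (x, A) \<in> ?T}" by blast
  qed
  ultimately show ?thesis by (simp add: closed_def)
qed

lemma posdef_congruence:
  fixes A :: "real ^ 'n ^ 'n" and Y :: "real ^ 'm ^ 'n"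
  assumes "A \<in> posdef" "L ** Y = mat 1"
  shows "transpose Y ** A ** Y \<in> posdef"
  unfolding posdef_def
proof (intro CollectI allI impI)
  fix x :: "real ^ 'm" assume "x \<noteq> 0"
  moreover have "L *v (Y *v x) = x" using assms(2) by (simp add: matrix_vector_mul_assoc)
  ultimately have "Y *v x \<noteq> 0" by auto
  then have "(Y *v x) \<bullet> (A *v (Y *v x)) > 0" using assms(1) by (simp add: posdef_def)
  then show "x \<bullet> ((transpose Y ** A ** Y) *v x) > 0"
    using inner_transpose[of "transpose Y" x "A *v (Y *v x)"]
    by (simp add: matrix_vector_mul_assoc matrix_mul_assoc del: transpose_matrix_vector)
qed

lemma posdef_mat_1: "mat 1 \<in> posdef"
  by (simp add: posdef_def)

lemma spd_congruence:
  assumes "A \<in> spd" "L ** Y = mat 1"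
  shows "transpose Y ** A ** Y \<in> spd"
  using posdef_congruence[of A L Y] assms by (simp add: spd_iff matrix_simps)

lemma spd_inverse:
  assumes "S \<in> spd"
  shows "invertible S" "transpose S = S" "S ** matrix_inv S = mat 1" "matrix_inv S ** S = mat 1"
    "transpose (matrix_inv S) = matrix_inv S"
proof -
  show *: "invertible S" "transpose S = S" using assms posdef_invertible by (auto simp: spd_iff)
  show "S ** matrix_inv S = mat 1" "matrix_inv S ** S = mat 1" using matrix_inv_mult * by auto
  show "transpose (matrix_inv S) = matrix_inv S" using transpose_matrix_inv * by metis
qed

lemma spd_matrix_inv:
  assumes "S \<in> spd"
  shows "matrix_inv S \<in> spd"
proof -
  note S = spd_inverse[OF assms]
  have "transpose (matrix_inv S) ** S ** matrix_inv S \<in> spd"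
    by (rule spd_congruence[OF assms S(3)])
  then show ?thesis using S by (simp add: matrix_simps)
qed

lemma spd_scaleR:
  assumes "S \<in> spd" "c > 0"
  shows "c *\<^sub>R S \<in> spd"
  using assms by (simp add: spd_iff posdef_def transpose_linear scaleR_matrix_vector_assoc[symmetric])

lemma spd_square:
  assumes "R \<in> spd"
  shows "R ** R \<in> spd"
proof -
  note R = spd_inverse[OF assms]
  have "transpose R ** mat 1 ** R \<in> spd"
    by (rule spd_congruence[OF _ R(4)]) (simp add: spd_iff posdef_mat_1)
  then show ?thesis by (simp add: R)
qed

lemma psd_kernel:
  fixes A :: "real ^ 'n ^ 'n"
  assumes sym: "transpose A = A" and psd: "\<And>x. x \<bullet> (A *v x) \<ge> 0" and x: "x \<bullet> (A *v x) = 0"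
  shows "A *v x = 0"
proof (rule ccontr)
  let ?y = "A *v x"
  assume "?y \<noteq> 0"
  then have b: "?y \<bullet> ?y > 0" by simp
  define c where "c = ?y \<bullet> (A *v ?y)"
  have c: "c \<ge> 0" unfolding c_def by (rule psd)
  \<comment> \<open>A step from \<open>x\<close> against the gradient makes the quadratic form negative.\<close>
  define t where "t = - (?y \<bullet> ?y) / (c + 1)"
  have "(x + t *\<^sub>R ?y) \<bullet> (A *v (x + t *\<^sub>R ?y)) = 2 * t * (?y \<bullet> ?y) + t\<^sup>2 * c"
    using x symmetric_inner_commute[OF sym, of x ?y]
    by (simp add: matrix_vector_right_distrib matrix_vector_mult_scaleR inner_simps c_def power2_eq_square algebra_simps)
  also have "\<dots> = - (t\<^sup>2 * (c + 2))"
  proof -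
    have b_eq: "?y \<bullet> ?y = - (t * (c + 1))" using c by (simp add: t_def)
    show ?thesis unfolding b_eq by (simp add: algebra_simps power2_eq_square)
  qed
  also have "\<dots> < 0" using b c by (simp add: t_def)
  finally show False using psd[of "x + t *\<^sub>R ?y"] by simp
qed

subsection \<open>The Moore-Penrose inverse\<close>

text \<open>
  Uniqueness in the Penrose equations: for two solutions \<open>X\<close> and \<open>Y\<close>, symmetry of \<open>A X\<close> and \<open>A Y\<close>
  turns \<open>A Y = (A X) (A Y)\<close> into \<open>A Y = A X\<close>; likewise \<open>Y A = X A\<close>, and then
  \<open>Y = Y A Y = X A X = X\<close>.
\<close>

lemma pseudoinverse_eqI:
  fixes A :: "real ^ 'n ^ 'm"
  assumes X: "A ** X ** A = A" "X ** A ** X = X" "transpose (A ** X) = A ** X" "transpose (X ** A) = X ** A"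
  shows "pseudoinverse A = X"
  unfolding pseudoinverse_def
proof (rule the_equality)
  show "A ** X ** A = A \<and> X ** A ** X = X \<and> transpose (A ** X) = A ** X \<and> transpose (X ** A) = X ** A"
    using X by blast
next
  fix Y
  assume Y: "A ** Y ** A = A \<and> Y ** A ** Y = Y \<and> transpose (A ** Y) = A ** Y \<and> transpose (Y ** A) = Y ** A"
  have "A ** Y = transpose (A ** Y) ** transpose (A ** X)"
  proof -
    have "transpose (A ** X ** A ** Y) = transpose (A ** Y) ** transpose (A ** X)"
      by (simp add: matrix_simps)
    then show ?thesis using X(1) Y by simp
  qed
  then have AY: "A ** Y = A ** X" using X(3) Y by (metis matrix_mul_assoc)
  have "Y ** A = transpose (X ** A) ** transpose (Y ** A)"
  proof -
    have "transpose (Y ** (A ** X ** A)) = transpose (X ** A) ** transpose (Y ** A)"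
      by (simp add: matrix_simps)
    then show ?thesis using X(1) Y by simp
  qed
  then have YA: "Y ** A = X ** A" using X(4) Y by (metis matrix_mul_assoc)
  show "Y = X" using Y X(2) AY YA by (metis matrix_mul_assoc)
qed


subsection \<open>Orthonormal frames\<close>

lemma stiefel_of_subspace:
  fixes V :: "(real ^ 'n) set"
  assumes "subspace V" "dim V = CARD('m)"
  shows "\<exists>X :: real ^ 'm ^ 'n. X \<in> stiefel \<and> range ((*v) X) = V"
proof -
  obtain B where B: "B \<subseteq> V" "pairwise orthogonal B" "\<And>x. x \<in> B \<Longrightarrow> norm x = 1"
    "independent B" "card B = dim V" "span B = V"
    using orthonormal_basis_subspace[OF assms(1)] by metis
  have "finite B" using B(4) independent_imp_finite by blast
  then obtain f where f: "bij_betw f (UNIV :: 'm set) B"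
    using B(5) assms(2) finite_same_card_bij[of "UNIV :: 'm set" B] by auto
  define X :: "real ^ 'm ^ 'n" where "X = (\<chi> i j. f j $ i)"
  have col: "column j X = f j" for j by (simp add: X_def column_def vec_eq_iff)
  have "f i \<bullet> f j = (if i = j then 1 else 0)" for i j
  proof (cases "i = j")
    case True
    have "norm (f i) = 1" using B(3) f bij_betwE by blast
    with True show ?thesis by (simp add: norm_eq_1)
  next
    case False
    then have "f i \<noteq> f j" using f by (auto simp: bij_betw_def inj_on_def)
    moreover have "f i \<in> B" "f j \<in> B" using f bij_betwE by blast+
    ultimately show ?thesis using False B(2) by (auto simp: pairwise_def orthogonal_def)
  qed
  then have "X \<in> stiefel"
    unfolding stiefel_def mem_Collect_eq matrix_mult_transpose_dot_column col
    by (simp add: mat_def vec_eq_iff)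
  moreover have "range ((*v) X) = V"
  proof
    show "range ((*v) X) \<subseteq> V"
    proof clarify
      fix x
      have "X *v x = (\<Sum>j\<in>UNIV. x $ j *\<^sub>R f j)"
        by (simp add: X_def matrix_vector_mult_def vec_eq_iff mult.commute)
      also have "\<dots> \<in> V" using assms(1) B(1) f bij_betwE
        by (intro subspace_sum subspace_scale) blast+
      finally show "X *v x \<in> V" .
    qed
    have "f j = X *v axis j 1" for j by (simp add: matrix_vector_mult_basis col)
    then have "B \<subseteq> range ((*v) X)" using f by (auto simp: bij_betw_def)
    moreover have "subspace (range ((*v) X))" by (intro linear_subspace_image) auto
    ultimately show "V \<subseteq> range ((*v) X)" using B(6) span_minimal by blast
  qed
  ultimately show ?thesis by blast
qed

lemma stiefelD: "U \<in> stiefel \<Longrightarrow> transpose U ** U = mat 1"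
  by (simp add: stiefel_def)

lemma card_le_of_stiefel:
  assumes "(U :: real ^ 'p ^ 'n) \<in> stiefel"
  shows "CARD('p) \<le> CARD('n)"
proof -
  have "\<exists>B. B ** U = mat 1" using stiefelD[OF assms] by blast
  then have "rank U = CARD('p)"
    by (simp add: full_rank_injective matrix_left_invertible_injective)
  then show ?thesis using rank_bound[of U] by simp
qed

lemma stiefel_complement:
  fixes U :: "real ^ 'p ^ 'n"
  assumes U: "U \<in> stiefel" and q: "CARD('q) = CARD('n) - CARD('p)"
  shows "\<exists>W :: real ^ 'q ^ 'n. W \<in> stiefel \<and> transpose U ** W = 0"
proof -
  let ?V = "{y \<in> UNIV. \<forall>x\<in>range ((*v) U). orthogonal x y}"
  have "\<exists>B. B ** U = mat 1" using stiefelD[OF U] by blast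
  then have "rank U = CARD('p)"
    by (simp add: full_rank_injective matrix_left_invertible_injective)
  moreover have "dim ?V + dim (range ((*v) U)) = dim (UNIV :: (real ^ 'n) set)"
    by (intro dim_subspace_orthogonal_to_vectors linear_subspace_image) auto
  ultimately have "dim ?V = CARD('q)" using q by (simp add: rank_dim_range)
  moreover have "subspace ?V" by (auto simp: subspace_def orthogonal_clauses)
  ultimately obtain W :: "real ^ 'q ^ 'n" where W: "W \<in> stiefel" "range ((*v) W) = ?V"
    using stiefel_of_subspace by blast
  have "transpose U *v (W *v y) = 0" for y
  proof -
    have "W *v y \<in> ?V" using W(2) by blast
    then have "x \<bullet> (transpose U *v (W *v y)) = 0" for x
      using inner_transpose[of U "W *v y" x] by (simp add: orthogonal_def inner_commute)
    then show ?thesis using inner_eq_zero_iff by blast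
  qed
  then have "transpose U ** W = 0" by (simp add: matrix_eq matrix_vector_mul_assoc)
  with W(1) show ?thesis by blast
qed

text \<open>
  The difference of the two sides is an orthogonal projection, so its trace is its squared norm;
  but the trace is \<open>n - p - q = 0\<close>.
\<close>

lemma stiefel_resolution:
  fixes U :: "real ^ 'p ^ 'n" and W :: "real ^ 'q ^ 'n"
  assumes U: "U \<in> stiefel" and W: "W \<in> stiefel" and UW: "transpose U ** W = 0"
    and q: "CARD('q) = CARD('n) - CARD('p)"
  shows "U ** transpose U + W ** transpose W = mat 1"
proof -
  have WU: "transpose W ** U = 0"
    using arg_cong[OF UW, of transpose] by (simp add: matrix_simps)
  note eqs = stiefelD[OF U] stiefelD[OF W] UW WU
  note eqs = eqs eqs[THEN matrix_mult_cancel_left]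
  define E where "E = mat 1 - (U ** transpose U + W ** transpose W)"
  have "transpose E ** E = E" unfolding E_def by (simp add: matrix_simps eqs)
  moreover have "trace E = 0"
  proof -
    have "trace (U ** transpose U) = CARD('p)" "trace (W ** transpose W) = CARD('q)"
      by (simp_all add: trace_mul_sym[of U] trace_mul_sym[of W] eqs trace_I)
    then show ?thesis using q card_le_of_stiefel[OF U]
      by (simp add: E_def trace_linear trace_I)
  qed
  ultimately have "E = 0" using trace_transpose_mult_self_eq_0(2)[of E] by simp
  then show ?thesis by (simp add: E_def)
qed

section \<open>Positive semidefinite matrices of fixed rank\<close>

text \<open>
  The columns of \<open>U\<close> are an orthonormal basis of the column space of \<open>A\<close>, and \<open>S = U\<^sup>T A U\<close>. The form of
  \<open>S\<close> is definite: where it vanishes, \<open>A\<close> vanishes too, but a symmetric matrix is injective on its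
  column space.
\<close>

lemma spsd_factorization:
  fixes A :: "real ^ 'n ^ 'n"
  assumes "A \<in> spsd CARD('p)"
  shows "\<exists>U \<in> stiefel. \<exists>S \<in> spd. A = U ** S ** transpose (U :: real ^ 'p ^ 'n)"
proof -
  have sym: "transpose A = A" and psd: "\<And>x. x \<bullet> (A *v x) \<ge> 0" and "rank A = CARD('p)"
    using assms by (auto simp: spsd_def sym_mat_def)
  then have "subspace (range ((*v) A))" "dim (range ((*v) A)) = CARD('p)"
    by (auto simp: rank_dim_range intro!: linear_subspace_image)
  then obtain U :: "real ^ 'p ^ 'n" where U: "U \<in> stiefel" "range ((*v) U) = range ((*v) A)"
    using stiefel_of_subspace by blast
  note UU = stiefelD[OF U(1)]
  have PA: "U ** transpose U ** A = A"
  proof -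
    have "U *v (transpose U *v (A *v x)) = A *v x" for x
    proof -
      obtain a where "A *v x = U *v a" using U(2) by (metis imageE rangeI)
      then show ?thesis using UU
        by (simp add: matrix_vector_mul_assoc matrix_mul_assoc[symmetric] del: transpose_matrix_vector)
    qed
    then show ?thesis by (simp add: matrix_eq matrix_vector_mul_assoc matrix_mul_assoc del: transpose_matrix_vector)
  qed
  have AP: "A ** U ** transpose U = A"
    using arg_cong[OF PA, of transpose] sym by (simp add: matrix_simps)
  define S where "S = transpose U ** A ** U"
  have "U ** S ** transpose U = (U ** transpose U ** A) ** U ** transpose U"
    by (simp add: S_def matrix_simps)
  then have A: "A = U ** S ** transpose U" using PA AP by simp
  have "transpose S = S" by (simp add: S_def matrix_simps sym)
  moreover have "S \<in> posdef" unfolding posdef_def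
  proof (intro CollectI allI impI)
    fix x :: "real ^ 'p" assume "x \<noteq> 0"
    have eq: "x \<bullet> (S *v x) = (U *v x) \<bullet> (A *v (U *v x))"
      using inner_transpose[of "transpose U" x "A *v (U *v x)"]
      by (simp add: S_def matrix_vector_mul_assoc matrix_mul_assoc del: transpose_matrix_vector)
    show "x \<bullet> (S *v x) > 0"
    proof (rule ccontr)
      assume "\<not> ?thesis"
      then have "A *v (U *v x) = 0" using eq psd[of "U *v x"] by (intro psd_kernel[OF sym psd]) auto
      moreover obtain y where y: "U *v x = A *v y" using U(2) by (metis imageE rangeI)
      ultimately have "(A *v y) \<bullet> (A *v y) = 0"
        using symmetric_inner_commute[OF sym, of "A *v y" y] by simp
      then have "U *v x = 0" using y by simp
      then have "transpose U *v (U *v x) = 0" by simp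
      then have "x = 0" using UU by (simp add: matrix_vector_mul_assoc del: transpose_matrix_vector)
      then show False using \<open>x \<noteq> 0\<close> by simp
    qed
  qed
  ultimately have "S \<in> spd" by (simp add: spd_iff)
  with A U(1) show ?thesis by blast
qed

lemma spsd_congruence:
  fixes Y :: "real ^ 'p ^ 'n"
  assumes S: "S \<in> spd" and L: "L ** Y = mat 1"
  shows "Y ** S ** transpose Y \<in> spsd CARD('p)"
proof -
  let ?A = "Y ** S ** transpose Y"
  have "x \<bullet> (?A *v x) \<ge> 0" for x
  proof -
    have "x \<bullet> (?A *v x) = (transpose Y *v x) \<bullet> (S *v (transpose Y *v x))"
      by (subst inner_transpose) (simp add: matrix_vector_mul_assoc matrix_mul_assoc del: transpose_matrix_vector)
    also have "\<dots> \<ge> 0"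
      using S by (cases "transpose Y *v x = 0") (auto simp: spd_iff posdef_def less_imp_le)
    finally show ?thesis .
  qed
  moreover have "transpose ?A = ?A" using S by (simp add: matrix_simps spd_iff)
  moreover have "rank ?A = CARD('p)"
  proof (rule antisym)
    have "rank ?A \<le> rank Y" using rank_mul_le_left[of Y "S ** transpose Y"] by (simp add: matrix_mul_assoc)
    also have "\<dots> \<le> CARD('p)" using rank_bound[of Y] by simp
    finally show "rank ?A \<le> CARD('p)" .
    have LT: "transpose Y ** transpose L = mat 1"
      using arg_cong[OF L, of transpose] by (simp add: matrix_transpose_mul)
    have "\<exists>B. B ** S = mat 1" using spd_inverse(4)[OF S] by blast
    then have "CARD('p) = rank S"
      by (metis full_rank_injective matrix_left_invertible_injective)
    also have "S = (L ** ?A) ** transpose L"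
      by (simp add: matrix_simps LT L[THEN matrix_mult_cancel_left])
    also have "rank \<dots> \<le> rank ?A" using rank_mul_le_left rank_mul_le_right order_trans by blast
    finally show "CARD('p) \<le> rank ?A" .
  qed
  ultimately show ?thesis by (simp add: spsd_def sym_mat_def)
qed

lemma spsd_frame:
  assumes "U \<in> stiefel" "S \<in> spd"
  shows "U ** S ** transpose (U :: real ^ 'p ^ 'n) \<in> spsd CARD('p)"
  using spsd_congruence stiefelD assms by blast

lemma pseudoinverse_frame:
  assumes U: "U \<in> stiefel" and S: "S \<in> spd"
  shows "pseudoinverse (U ** S ** transpose U) = U ** matrix_inv S ** transpose U"
proof -
  note S = spd_inverse[OF S]
  note eqs = stiefelD[OF U] S(3,4)
  note eqs = eqs eqs[THEN matrix_mult_cancel_left]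
  show ?thesis by (rule pseudoinverse_eqI) (simp_all add: matrix_simps eqs)
qed

text \<open>
  The Nystrom formula: a positive semidefinite matrix of rank \<open>p\<close> is determined by its action
  on a \<open>p\<close>-frame on which it is definite.
\<close>

lemma spsd_nystrom:
  fixes U :: "real ^ 'p ^ 'n"
  assumes A: "A \<in> spsd CARD('p)" and pd: "transpose U ** A ** U \<in> posdef"
  shows "A ** U ** matrix_inv (transpose U ** A ** U) ** transpose U ** A = A"
proof -
  obtain V :: "real ^ 'p ^ 'n" and S where V: "V \<in> stiefel" "S \<in> spd" and AV: "A = V ** S ** transpose V"
    using spsd_factorization[OF A] by blast
  note S = spd_inverse[OF V(2)]
  define C where "C = transpose U ** V"
  have CT: "transpose C = transpose V ** U" by (simp add: C_def matrix_simps)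
  have eq: "transpose U ** A ** U = C ** S ** transpose C" by (simp add: AV C_def matrix_simps)
  have "invertible (C ** S ** transpose C)" using posdef_invertible[OF pd] eq by simp
  then have "C ** (S ** transpose C ** matrix_inv (C ** S ** transpose C)) = mat 1"
    using matrix_inv_mult(1) by (simp add: matrix_mul_assoc)
  then have C: "invertible C" by (rule invertibleI)
  note Ci = matrix_inv_mult[OF C]
  have CTi: "transpose (matrix_inv C) ** transpose C = mat 1" "transpose C ** transpose (matrix_inv C) = mat 1"
    using Ci by (metis matrix_transpose_mul transpose_mat)+
  note eqs = Ci CTi S(3,4)
  note eqs = eqs eqs[THEN matrix_mult_cancel_left]
  have "matrix_inv (C ** S ** transpose C) = transpose (matrix_inv C) ** matrix_inv S ** matrix_inv C"
    by (rule matrix_inv_unique) (simp add: matrix_simps eqs)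
  moreover have "A ** U = V ** S ** transpose C" "transpose U ** A = C ** S ** transpose V"
    by (simp_all add: AV C_def matrix_simps)
  ultimately show ?thesis unfolding eq
    by (simp add: matrix_mul_assoc[symmetric] eqs AV)
qed

subsection \<open>Positivity of the trace form\<close>

text \<open>
  Completing the square in the direction \<open>x\<close> splits off a rank-one summand and puts \<open>x\<close>
  into the kernel of the remainder.
\<close>

lemma psd_eq_sum_rank_one:
  fixes A :: "real ^ 'n ^ 'n"
  assumes "transpose A = A" "\<And>x. x \<bullet> (A *v x) \<ge> 0"
  shows "\<exists>m v. A = (\<Sum>l<m::nat. \<chi> i j. v l $ i * v l $ j)"
  using assms
proof (induction "CARD('n) - dim {y. A *v y = 0}" arbitrary: A rule: less_induct)
  case less
  note sym = less.prems(1) and psd = less.prems(2)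
  show ?case
  proof (cases "A = 0")
    case True
    then show ?thesis by (intro exI[of _ 0]) simp
  next
    case False
    then obtain x where x: "A *v x \<noteq> 0" by (auto simp: matrix_eq)
    define c where "c = x \<bullet> (A *v x)"
    have c: "c > 0"
      using psd_kernel[OF sym psd] x psd[of x] unfolding c_def by (metis less_eq_real_def)
    define w where "w = (1 / sqrt c) *\<^sub>R (A *v x)"
    define A' where "A' = A - (\<chi> i j. w $ i * w $ j)"
    have A'v: "A' *v y = A *v y - (w \<bullet> y) *\<^sub>R w" for y
      by (simp add: A'_def vec_eq_iff matrix_vector_mult_def inner_vec_def left_diff_distrib right_diff_distrib
          sum_subtractf sum_distrib_left sum_distrib_right ac_simps)
    have wy: "w \<bullet> y = (y \<bullet> (A *v x)) / sqrt c" for y by (simp add: w_def inner_commute)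
    have sym': "transpose A' = A'"
      using sym by (simp add: A'_def transpose_def vec_eq_iff mult.commute)
    have psd': "y \<bullet> (A' *v y) \<ge> 0" for y
    proof -
      define b where "b = y \<bullet> (A *v x)"
      have b': "x \<bullet> (A *v y) = b" using symmetric_inner_commute[OF sym] by (simp add: b_def)
      have "0 \<le> (y - (b / c) *\<^sub>R x) \<bullet> (A *v (y - (b / c) *\<^sub>R x))" by (rule psd)
      also have "\<dots> = y \<bullet> (A *v y) - (b / c) * b - (b / c) * b + (b / c) * (b / c) * c"
        by (simp add: matrix_vector_mult_diff_distrib matrix_vector_mult_scaleR inner_simps
            b' b_def[symmetric] c_def[symmetric] algebra_simps)
      also have "\<dots> = y \<bullet> (A *v y) - b\<^sup>2 / c" using c by (simp add: power2_eq_square)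
      also have "\<dots> = y \<bullet> (A' *v y)"
        using c by (simp add: A'v inner_diff_right inner_commute[of y w] wy b_def[symmetric] power2_eq_square)
      finally show ?thesis .
    qed
    have sub: "subspace {y. B *v y = 0}" for B :: "real ^ 'n ^ 'n"
      by (auto simp: subspace_def matrix_vector_right_distrib matrix_vector_mult_scaleR)
    have "{y. A *v y = 0} \<subset> {y. A' *v y = 0}"
    proof
      show "{y. A *v y = 0} \<subseteq> {y. A' *v y = 0}"
      proof clarify
        fix y assume y: "A *v y = 0"
        then have "w \<bullet> y = 0" using symmetric_inner_commute[OF sym, of y x] by (simp add: wy)
        then show "A' *v y = 0" using y by (simp add: A'v)
      qed
      have "(w \<bullet> x) *\<^sub>R w = A *v x"
        using c by (simp add: wy c_def[symmetric]) (simp add: w_def)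
      then have "A' *v x = 0" by (simp add: A'v)
      then show "{y. A *v y = 0} \<noteq> {y. A' *v y = 0}" using x by blast
    qed
    then have "dim {y. A *v y = 0} < dim {y. A' *v y = 0}"
      using dim_psubset sub by (metis span_eq_iff)
    moreover have "dim {y. A' *v y = 0} \<le> CARD('n)" using dim_subset_UNIV_cart by blast
    ultimately have "CARD('n) - dim {y. A' *v y = 0} < CARD('n) - dim {y. A *v y = 0}" by simp
    from less.hyps[OF this sym' psd'] obtain m :: nat and v where
      v: "A' = (\<Sum>l<m. \<chi> i j. v l $ i * v l $ j)" by blast
    have "A = (\<Sum>l<Suc m. \<chi> i j. (v(m := w)) l $ i * (v(m := w)) l $ j)"
      using v by (simp add: A'_def algebra_simps)
    then show ?thesis by blast
  qed
qed

text \<open>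
  Writing one factor \<open>T\<close> as a sum of rank-one matrices \<open>v v\<^sup>T\<close> turns the trace
  into a sum of the nonnegative numbers \<open>(D v) \<bullet> (T (D v))\<close>.
\<close>

lemma trace_spd_form_pos:
  fixes T :: "real ^ 'n ^ 'n"
  assumes T: "T \<in> spd" and D: "transpose D = D"
  shows "trace (T ** D ** T ** D) \<ge> 0" "trace (T ** D ** T ** D) = 0 \<longleftrightarrow> D = 0"
proof -
  have pd: "x \<noteq> 0 \<Longrightarrow> x \<bullet> (T *v x) > 0" and sym: "transpose T = T" for x
    using T by (auto simp: spd_iff posdef_def)
  then have psd: "x \<bullet> (T *v x) \<ge> 0" for x by (cases "x = 0") (auto simp: less_imp_le)
  obtain m :: nat and v where v: "T = (\<Sum>l<m. \<chi> i j. v l $ i * v l $ j)"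
    using psd_eq_sum_rank_one[OF sym psd] by blast
  let ?O = "\<lambda>l. \<chi> i j. v l $ i * v l $ j :: real ^ 'n ^ 'n"
  have tr: "trace (?O l ** B) = v l \<bullet> (B *v v l)" for l B
    unfolding trace_def matrix_matrix_mult_def inner_vec_def matrix_vector_mult_def
    by (simp add: sum_distrib_left ac_simps, subst sum.swap) (simp add: ac_simps)
  have "trace (T ** D ** T ** D) = trace ((\<Sum>l<m. ?O l) ** (D ** T ** D))"
    using v by (simp add: matrix_mul_assoc)
  also have "\<dots> = (\<Sum>l<m. trace (?O l ** (D ** T ** D)))"
    by (simp add: matrix_mult.sum_left linear_sum[OF bounded_linear.linear[OF bounded_linear_trace]])
  also have "\<dots> = (\<Sum>l<m. (D *v v l) \<bullet> (T *v (D *v v l)))"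
  proof (intro sum.cong refl)
    fix l
    have "v l \<bullet> (D ** T ** D *v v l) = (transpose D *v v l) \<bullet> (T *v (D *v v l))"
      by (subst inner_transpose) (simp add: matrix_vector_mul_assoc matrix_mul_assoc)
    then show "trace (?O l ** (D ** T ** D)) = (D *v v l) \<bullet> (T *v (D *v v l))"
      unfolding tr D .
  qed
  finally have eq: "trace (T ** D ** T ** D) = (\<Sum>l<m. (D *v v l) \<bullet> (T *v (D *v v l)))" .
  show "trace (T ** D ** T ** D) \<ge> 0" unfolding eq by (intro sum_nonneg psd)
  show "trace (T ** D ** T ** D) = 0 \<longleftrightarrow> D = 0"
  proof
    assume "trace (T ** D ** T ** D) = 0"
    then have "\<forall>l<m. (D *v v l) \<bullet> (T *v (D *v v l)) = 0"
      unfolding eq using psd by (subst (asm) sum_nonneg_eq_0_iff) auto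
    then have Dv: "D *v v l = 0" if "l < m" for l using pd that by (metis less_irrefl)
    have "D ** ?O l = (\<chi> i j. (D *v v l) $ i * v l $ j)" for l
      by (simp add: matrix_matrix_mult_def matrix_vector_mult_def vec_eq_iff sum_distrib_right mult.assoc)
    then have "D ** ?O l = 0" if "l < m" for l using Dv[OF that] by (simp add: vec_eq_iff)
    then have "D ** T = 0" unfolding v by (simp add: matrix_mult.sum_right)
    then have "D ** T ** matrix_inv T = 0" by (simp add: matrix_mult.zero_left)
    then show "D = 0" using spd_inverse(3)[OF T] by (simp add: matrix_mul_assoc[symmetric])
  qed (simp add: matrix_simps trace_linear)
qed

subsection \<open>Smoothness of the pseudoinverse\<close>

lemmas Ck_on_matrix_mult = Ck_on_bilinear[OF bounded_bilinear_matrix_mult]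
lemmas Ck_on_id = Ck_on_linear[OF bounded_linear_ident]

lemma Ck_on_transpose: "Ck_on k S f \<Longrightarrow> Ck_on k S (\<lambda>x. transpose (f x :: real ^ 'n ^ 'm))"
  using Ck_on_compose[OF Ck_on_linear[OF bounded_linear_transpose, of k UNIV]] by blast

lemma Ck_on_matrix_inv_compose:
  fixes f :: "'a::euclidean_space \<Rightarrow> real ^ 'n ^ 'n"
  assumes "Ck_on k S f" "\<And>x. x \<in> S \<Longrightarrow> invertible (f x)"
  shows "Ck_on k S (\<lambda>x. matrix_inv (f x))"
  using Ck_on_compose[OF Ck_on_matrix_inv assms(1)] assms(2) by blast

text \<open>
  The domain of the local formulas around a matrix whose column space is spanned by the columns of
  \<open>U\<close>. Symmetry of \<open>A\<close> is not demanded, which makes the set open in the space of all matrices.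
\<close>

definition definite_on :: "real ^ 'p ^ 'n \<Rightarrow> (real ^ 'n ^ 'n) set" where
  "definite_on U = {A. transpose U ** A ** U \<in> posdef}"

lemma open_definite_on: "open (definite_on U)"
proof -
  have "Ck_on 0 UNIV (\<lambda>A. transpose U ** A ** U)"
    by (intro Ck_on_matrix_mult Ck_on_const Ck_on_id)
  then have "open ((\<lambda>A. transpose U ** A ** U) -` posdef)"
    by (intro open_vimage open_posdef) simp
  moreover have "(\<lambda>A. transpose U ** A ** U) -` posdef = definite_on U"
    by (auto simp: definite_on_def)
  ultimately show ?thesis by simp
qed

lemma frame_in_definite_on: "U \<in> stiefel \<Longrightarrow> S \<in> spd \<Longrightarrow> U ** S ** transpose U \<in> definite_on U"
  by (simp add: definite_on_def matrix_simps spd_iff stiefelD stiefelD[THEN matrix_mult_cancel_left])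

lemma gram_spd:
  fixes Y :: "real ^ 'p ^ 'n"
  assumes "L ** Y = mat 1"
  shows "transpose Y ** Y \<in> spd"
  using spd_congruence[OF _ assms, of "mat 1"] posdef_mat_1 by (simp add: spd_iff)

text \<open>
  For \<open>A\<close> of rank \<open>p\<close> in \<open>definite_on U\<close> the columns of \<open>Y = A U\<close> are a basis of the column space that
  depends smoothly on \<open>A\<close>, and \<open>A = Y M\<^sup>-\<^sup>1 Y\<^sup>T\<close> with \<open>M = U\<^sup>T A U\<close>. With \<open>G = (Y\<^sup>T Y)\<^sup>-\<^sup>1\<close> the
  pseudoinverse is then \<open>Y G M G Y\<^sup>T\<close>, an expression that is defined and smooth on the whole open set.
\<close>

lemma smooth_on_pseudoinverse:
  "smooth_on (spsd CARD('p::finite) :: (real ^ 'n ^ 'n) set) pseudoinverse"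
  unfolding smooth_on_def
proof
  fix A\<^sub>0 :: "real ^ 'n ^ 'n"
  assume "A\<^sub>0 \<in> spsd CARD('p)"
  then obtain U :: "real ^ 'p ^ 'n" and S where US: "U \<in> stiefel" "S \<in> spd" "A\<^sub>0 = U ** S ** transpose U"
    using spsd_factorization by blast
  define F where "F A = (A ** U) ** matrix_inv (transpose (A ** U) ** (A ** U)) ** (transpose U ** A ** U)
    ** matrix_inv (transpose (A ** U) ** (A ** U)) ** transpose (A ** U)" for A
  have left_inverse: "matrix_inv (transpose U ** A ** U) ** transpose U ** (A ** U) = mat 1"
    if "A \<in> definite_on U" for A
    using matrix_inv_mult(2)[OF posdef_invertible, of "transpose U ** A ** U"] that
    by (simp add: definite_on_def matrix_mul_assoc)
  have smooth: "Ck_on k (definite_on U) F" for k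
    unfolding F_def
    by (intro Ck_on_matrix_mult Ck_on_matrix_inv_compose Ck_on_transpose Ck_on_const Ck_on_id)
       (auto intro: spd_inverse(1) gram_spd left_inverse)
  have ext: "F A = pseudoinverse A" if A: "A \<in> spsd CARD('p) \<inter> definite_on U" for A
  proof (rule pseudoinverse_eqI[symmetric])
    define Y where "Y = A ** U"
    define M where "M = transpose U ** A ** U"
    define G where "G = matrix_inv (transpose Y ** Y)"
    have sym: "transpose A = A" using A by (simp add: spsd_def sym_mat_def)
    have "M \<in> spd"
      using A sym by (simp add: spd_iff M_def definite_on_def matrix_simps)
    note M = spd_inverse[OF this]
    have "transpose Y ** Y \<in> spd"
      unfolding Y_def using A by (intro gram_spd[OF left_inverse]) auto
    note G = spd_inverse[OF this, folded G_def]
    have AY: "A = Y ** matrix_inv M ** transpose Y"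
      using spsd_nystrom[of A U] A sym by (simp add: definite_on_def Y_def M_def matrix_simps)
    have F: "F A = Y ** G ** M ** G ** transpose Y"
      by (simp add: F_def G_def M_def Y_def)
    have YY: "transpose Y ** (Y ** G) = mat 1" "G ** (transpose Y ** Y) = mat 1"
      using G(3,4) by (simp_all add: matrix_mul_assoc)
    have YY': "transpose Y ** (Y ** (G ** X)) = X" "G ** (transpose Y ** (Y ** X)) = X"
      for X :: "real ^ 'k ^ 'p"
      using G(3,4) by (simp_all add: matrix_mul_assoc)
    note eqs = M(3,4) M(3,4)[THEN matrix_mult_cancel_left] M(2,5) G(5) YY YY'
    show "A ** F A ** A = A" "F A ** A ** F A = F A"
      "transpose (A ** F A) = A ** F A" "transpose (F A ** A) = F A ** A"
      unfolding F by (simp_all add: AY matrix_simps eqs)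
  qed
  show "\<exists>T F. open T \<and> A\<^sub>0 \<in> T \<and> (\<forall>k. Ck_on k T F) \<and>
      (\<forall>A\<in>spsd CARD('p) \<inter> T. F A = pseudoinverse A)"
    by (rule exI[of _ "definite_on U"], rule exI[of _ F])
       (use open_definite_on frame_in_definite_on US smooth ext in blast)
qed

subsection \<open>Slice charts\<close>

text \<open>
  In the block decomposition given by frames \<open>U\<close> and \<open>W\<close>, a symmetric matrix that is definite on \<open>U\<close>
  has rank \<open>p\<close> and is positive semidefinite exactly if its Schur complement, the value at \<open>c = -1\<close> of the
  \<open>W\<close>-block below, is 0. Subtracting the Schur term is undone by adding it, because the
  term does not involve the \<open>W\<close>-block.
\<close>

definition schur_shear :: "real \<Rightarrow> real ^ 'p ^ 'n \<Rightarrow> real ^ 'q ^ 'n \<Rightarrow> real ^ 'n ^ 'n \<Rightarrow> real ^ 'n ^ 'n" where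
  "schur_shear c U W A = A + c *\<^sub>R (W ** transpose W ** A ** U **
     matrix_inv (transpose U ** A ** U) ** transpose U ** A ** W ** transpose W)"

lemma Ck_on_scaleR: "Ck_on k S f \<Longrightarrow> Ck_on k S (\<lambda>x. c *\<^sub>R f x)"
  by (rule Ck_on_bilinear[OF bounded_bilinear_scaleR Ck_on_const])

lemma Ck_on_schur_shear: "Ck_on k (definite_on U) (schur_shear c U W)"
  unfolding schur_shear_def
  by (intro Ck_on_add Ck_on_scaleR Ck_on_matrix_mult Ck_on_matrix_inv_compose Ck_on_const Ck_on_id)
     (auto simp: definite_on_def intro: posdef_invertible)

lemma complementary_frames:
  assumes "U \<in> stiefel" "W \<in> stiefel" "transpose U ** W = 0"
  shows "transpose U ** U = mat 1" "transpose W ** W = mat 1" "transpose U ** W = 0" "transpose W ** U = 0"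
proof -
  show "transpose U ** U = mat 1" "transpose W ** W = mat 1" "transpose U ** W = 0"
    using assms stiefelD by auto
  show "transpose W ** U = 0"
    using arg_cong[OF assms(3), of transpose] by (simp add: matrix_simps)
qed

lemma eq_if_blocks_eq:
  fixes U :: "real ^ 'p ^ 'n" and W :: "real ^ 'q ^ 'n" and A B :: "real ^ 'n ^ 'n"
  assumes res: "U ** transpose U + W ** transpose W = mat 1"
    and "transpose U ** A ** U = transpose U ** B ** U" "transpose U ** A ** W = transpose U ** B ** W"
    and "transpose W ** A ** U = transpose W ** B ** U" "transpose W ** A ** W = transpose W ** B ** W"
  shows "A = B"
proof -
  have dec: "X = U ** (transpose U ** X ** U) ** transpose U + U ** (transpose U ** X ** W) ** transpose W
    + W ** (transpose W ** X ** U) ** transpose U + W ** (transpose W ** X ** W) ** transpose W"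
    for X :: "real ^ 'n ^ 'n"
  proof -
    have "X = (U ** transpose U + W ** transpose W) ** X ** (U ** transpose U + W ** transpose W)"
      by (simp add: res)
    also have "\<dots> = U ** (transpose U ** X ** U) ** transpose U + U ** (transpose U ** X ** W) ** transpose W
    + W ** (transpose W ** X ** U) ** transpose U + W ** (transpose W ** X ** W) ** transpose W"
      by (simp add: matrix_simps)
    finally show ?thesis .
  qed
  show ?thesis by (subst dec[of A], subst dec[of B]) (simp add: assms(2-))
qed

context
  fixes U :: "real ^ 'p ^ 'n" and W :: "real ^ 'q ^ 'n"
  assumes U: "U \<in> stiefel" and W: "W \<in> stiefel" and UW: "transpose U ** W = 0"
    and q: "CARD('q) = CARD('n) - CARD('p)"
begin

lemma schur_shear_mult:
  "transpose U ** schur_shear c U W A = transpose U ** A" "schur_shear c U W A ** U = A ** U"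
proof -
  note eqs = complementary_frames[OF U W UW]
  note eqs = eqs eqs[THEN matrix_mult_cancel_left]
  show "transpose U ** schur_shear c U W A = transpose U ** A" "schur_shear c U W A ** U = A ** U"
    by (simp_all add: schur_shear_def matrix_simps eqs)
qed

lemma schur_shear_in_definite_on: "schur_shear c U W A \<in> definite_on U \<longleftrightarrow> A \<in> definite_on U"
  by (simp add: definite_on_def schur_shear_mult)

lemma schur_shear_schur_shear: "schur_shear c U W (schur_shear d U W A) = schur_shear (c + d) U W A"
proof -
  let ?B = "schur_shear d U W A"
  have "schur_shear c U W ?B = ?B + c *\<^sub>R (W ** transpose W ** (?B ** U) **
     matrix_inv (transpose U ** ?B ** U) ** (transpose U ** ?B) ** W ** transpose W)"
    by (simp add: schur_shear_def[of c] matrix_mul_assoc)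
  also have "\<dots> = schur_shear (c + d) U W A"
    unfolding schur_shear_mult by (simp add: schur_shear_def matrix_mul_assoc scaleR_left_distrib)
  finally show ?thesis .
qed

lemma schur_shear_inverse:
  "schur_shear 1 U W (schur_shear (-1) U W A) = A" "schur_shear (-1) U W (schur_shear 1 U W A) = A"
  unfolding schur_shear_schur_shear by (simp_all add: schur_shear_def)

lemma schur_shear_image_spsd:
  "schur_shear (-1) U W ` (spsd CARD('p) \<inter> definite_on U) =
     {B \<in> sym_mat. transpose W ** B ** W = 0} \<inter> definite_on U"
proof (intro set_eqI iffI)
  note eqs = complementary_frames[OF U W UW]
  note eqs = eqs eqs[THEN matrix_mult_cancel_left]
  {
    fix B assume "B \<in> schur_shear (-1) U W ` (spsd CARD('p) \<inter> definite_on U)"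
    then obtain A where A: "A \<in> spsd CARD('p)" "A \<in> definite_on U" and B: "B = schur_shear (-1) U W A"
      by blast
    have sym: "transpose A = A" using A by (simp add: spsd_def sym_mat_def)
    have "transpose U ** A ** U \<in> spd" using A(2) sym by (simp add: spd_iff definite_on_def matrix_simps)
    note M = spd_inverse(5)[OF this]
    have "transpose B = B"
      using M by (simp add: B schur_shear_def matrix_simps sym)
    have "transpose W ** B ** W = transpose W ** (A - A ** U ** matrix_inv (transpose U ** A ** U) **
        transpose U ** A) ** W"
      by (simp add: B schur_shear_def matrix_simps eqs)
    moreover have "A ** U ** matrix_inv (transpose U ** A ** U) ** transpose U ** A = A"
      using A by (intro spsd_nystrom) (auto simp: definite_on_def)
    ultimately have WBW: "transpose W ** B ** W = 0"
      by (simp only: diff_self matrix_mult.zero_left matrix_mult.zero_right)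
    with WBW show "B \<in> {B \<in> sym_mat. transpose W ** B ** W = 0} \<inter> definite_on U"
      using \<open>transpose B = B\<close> A(2) B schur_shear_in_definite_on by (simp add: sym_mat_def)
  }
  {
    fix B assume "B \<in> {B \<in> sym_mat. transpose W ** B ** W = 0} \<inter> definite_on U"
    then have sym: "transpose B = B" and WB: "transpose W ** (B ** W) = 0" and def: "B \<in> definite_on U"
      by (auto simp: sym_mat_def matrix_mul_assoc)
    define M where "M = transpose U ** B ** U"
    have Mspd: "M \<in> spd" using def sym by (simp add: M_def spd_iff definite_on_def matrix_simps)
    note M = spd_inverse[OF this]
    have M1: "matrix_inv M ** (transpose U ** (B ** U)) = mat 1" "transpose U ** (B ** (U ** matrix_inv M)) = mat 1"
      using M(3,4) by (simp_all add: M_def matrix_mul_assoc)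
    have M2: "matrix_inv M ** (transpose U ** (B ** (U ** X))) = X"
      "transpose U ** (B ** (U ** (matrix_inv M ** X))) = X" for X :: "real ^ 'k ^ 'p"
      using M(3,4) by (simp_all add: M_def matrix_mul_assoc)
    have UBU: "transpose U ** (B ** U) = M" by (simp add: M_def matrix_mul_assoc)
    define A where "A = schur_shear 1 U W B"
    have "A = (B ** U) ** matrix_inv M ** transpose (B ** U)"
      by (rule eq_if_blocks_eq[OF stiefel_resolution[OF U W UW q]])
         (simp_all add: A_def schur_shear_def UBU matrix_simps eqs sym WB M M1 M2)
    moreover have "(matrix_inv M ** transpose U) ** (B ** U) = mat 1"
      using M1 by (simp add: matrix_mul_assoc)
    ultimately have "A \<in> spsd CARD('p)" using spsd_congruence spd_matrix_inv[OF Mspd] by metis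
    moreover have "A \<in> definite_on U" using def schur_shear_in_definite_on by (simp add: A_def)
    moreover have "B = schur_shear (-1) U W A" by (simp add: A_def schur_shear_inverse)
    ultimately show "B \<in> schur_shear (-1) U W ` (spsd CARD('p) \<inter> definite_on U)" by blast
  }
qed

end

lemma spsd_orthogonal_conj:
  fixes A :: "real ^ 'n ^ 'n"
  assumes "A \<in> spsd CARD('p::finite)" "orthogonal_matrix Q"
  shows "Q ** A ** transpose Q \<in> spsd CARD('p)"
proof -
  obtain U :: "real ^ 'p ^ 'n" and S where US: "U \<in> stiefel" "S \<in> spd" "A = U ** S ** transpose U"
    using spsd_factorization[OF assms(1)] by blast
  have "(transpose U ** transpose Q) ** (Q ** U) = mat 1"
    using assms(2) stiefelD[OF US(1)]
    by (simp add: orthogonal_matrix_def matrix_simps matrix_mult_cancel_left[of "transpose Q" Q "mat 1"])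
  then have "(Q ** U) ** S ** transpose (Q ** U) \<in> spsd CARD('p)"
    using spsd_congruence US(2) by blast
  then show ?thesis by (simp add: US(3) matrix_simps)
qed

text \<open>
  The charts around different points are obtained from one chart by conjugation with orthogonal
  matrices, under which the set is invariant; this is how they come to share a model subspace.
\<close>

lemma embedded_submanifold_spsd:
  assumes q: "CARD('q::finite) = CARD('n) - CARD('p)"
  shows "embedded_submanifold (spsd CARD('p::finite) :: (real ^ 'n ^ 'n) set)"
proof (cases "(spsd CARD('p) :: (real ^ 'n ^ 'n) set) = {}")
  case True
  then show ?thesis
    unfolding embedded_submanifold_def using subspace_UNIV by blast
next
  case False
  let ?N = "spsd CARD('p) :: (real ^ 'n ^ 'n) set"
  obtain U :: "real ^ 'p ^ 'n" where U: "U \<in> stiefel"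
    using False spsd_factorization[where 'p = 'p] by blast
  obtain W :: "real ^ 'q ^ 'n" where W: "W \<in> stiefel" and UW: "transpose U ** W = 0"
    using stiefel_complement[OF U q] by blast
  note frame = U W UW q
  let ?T' = "definite_on U" and ?E = "{B \<in> sym_mat. transpose W ** B ** W = 0}"
  have "subspace ?E"
    by (auto simp: subspace_def sym_mat_def matrix_simps)
  moreover have "\<exists>T T' \<phi> \<psi>. open T \<and> A \<in> T \<and> open T' \<and> homeomorphism T T' \<phi> \<psi> \<and>
      smooth_on T \<phi> \<and> smooth_on T' \<psi> \<and> \<phi> ` (?N \<inter> T) = ?E \<inter> T'" if A: "A \<in> ?N" for A
  proof -
    obtain U\<^sub>A :: "real ^ 'p ^ 'n" and S where UA: "U\<^sub>A \<in> stiefel" "S \<in> spd" "A = U\<^sub>A ** S ** transpose U\<^sub>A"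
      using spsd_factorization[OF A] by blast
    obtain W\<^sub>A :: "real ^ 'q ^ 'n" where WA: "W\<^sub>A \<in> stiefel" "transpose U\<^sub>A ** W\<^sub>A = 0"
      using stiefel_complement[OF UA(1) q] by blast
    note eqs = complementary_frames[OF U W UW] complementary_frames[OF UA(1) WA]
    note eqs = eqs eqs[THEN matrix_mult_cancel_left]
    \<comment> \<open>The orthogonal matrix that moves the reference frames to the frames at \<open>A\<close>.\<close>
    define Q where "Q = U\<^sub>A ** transpose U + W\<^sub>A ** transpose W"
    have "transpose Q ** Q = mat 1" "Q ** transpose Q = mat 1"
      using stiefel_resolution[OF frame] stiefel_resolution[OF UA(1) WA q]
      by (simp_all add: Q_def matrix_simps eqs)
    then have Q: "orthogonal_matrix Q" "orthogonal_matrix (transpose Q)"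
      and QQ: "transpose Q ** Q = mat 1" "Q ** transpose Q = mat 1"
      by (auto simp: orthogonal_matrix_def)
    note QQ = QQ QQ[THEN matrix_mult_cancel_left]
    have QU: "Q ** U = U\<^sub>A" "transpose U ** transpose Q = transpose U\<^sub>A"
      by (simp_all add: Q_def matrix_simps eqs)
    define conj where "conj B = transpose Q ** B ** Q" for B
    define conj' where "conj' B = Q ** B ** transpose Q" for B
    have conj_inv: "conj (conj' B) = B" "conj' (conj B) = B" for B
      by (simp_all add: conj_def conj'_def matrix_simps QQ)
    have Ck_conj: "Ck_on k T conj" "Ck_on k T conj'" for k T
      unfolding conj_def conj'_def by (intro Ck_on_matrix_mult Ck_on_const Ck_on_id)+
    have conj_def_on: "conj B \<in> ?T' \<longleftrightarrow> B \<in> definite_on U\<^sub>A" for B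
      by (simp add: definite_on_def conj_def QU[symmetric] matrix_simps)
    then have conj'_def_on: "B \<in> ?T' \<longleftrightarrow> conj' B \<in> definite_on U\<^sub>A" for B
      using conj_inv(1) by metis
    have conj_N: "conj ` (?N \<inter> definite_on U\<^sub>A) = ?N \<inter> ?T'"
    proof (intro set_eqI iffI)
      fix B assume "B \<in> conj ` (?N \<inter> definite_on U\<^sub>A)"
      then show "B \<in> ?N \<inter> ?T'"
        using spsd_orthogonal_conj[OF _ Q(2)] conj_def_on by (auto simp: conj_def)
    next
      fix B assume "B \<in> ?N \<inter> ?T'"
      then have "conj' B \<in> ?N \<inter> definite_on U\<^sub>A"
        using spsd_orthogonal_conj[OF _ Q(1)] conj'_def_on by (auto simp: conj'_def)
      then show "B \<in> conj ` (?N \<inter> definite_on U\<^sub>A)" using conj_inv(1) by (metis imageI)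
    qed
    define \<phi> where "\<phi> B = schur_shear (-1) U W (conj B)" for B
    define \<psi> where "\<psi> B = conj' (schur_shear 1 U W B)" for B
    have \<phi>: "Ck_on k (definite_on U\<^sub>A) \<phi>" for k
      unfolding \<phi>_def using conj_def_on by (intro Ck_on_compose[OF Ck_on_schur_shear Ck_conj(1)]) auto
    have \<psi>: "Ck_on k ?T' \<psi>" for k
      unfolding \<psi>_def by (intro Ck_on_compose[OF Ck_conj(2)[of k UNIV] Ck_on_schur_shear]) auto
    have inv: "\<psi> (\<phi> B) = B" "\<phi> (\<psi> B) = B" for B
      by (simp_all add: \<phi>_def \<psi>_def schur_shear_inverse[OF frame] conj_inv)
    have maps: "\<phi> B \<in> ?T' \<longleftrightarrow> B \<in> definite_on U\<^sub>A" for B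
      by (simp add: \<phi>_def schur_shear_in_definite_on[OF frame] conj_def_on)
    have "homeomorphism (definite_on U\<^sub>A) ?T' \<phi> \<psi>"
    proof (rule homeomorphismI)
      show "continuous_on (definite_on U\<^sub>A) \<phi>" "continuous_on ?T' \<psi>"
        using \<phi>[of 0] \<psi>[of 0] by simp_all
      show "\<phi> ` definite_on U\<^sub>A \<subseteq> ?T'" using maps by blast
      show "\<psi> ` ?T' \<subseteq> definite_on U\<^sub>A" using maps inv(2) by (metis image_subsetI)
    qed (simp_all add: inv)
    moreover have "\<phi> ` (?N \<inter> definite_on U\<^sub>A) = ?E \<inter> ?T'"
      unfolding schur_shear_image_spsd[OF frame, symmetric] conj_N[symmetric] image_image \<phi>_def ..
    ultimately have chart: "open (definite_on U\<^sub>A) \<and> A \<in> definite_on U\<^sub>A \<and> open ?T' \<and>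
        homeomorphism (definite_on U\<^sub>A) ?T' \<phi> \<psi> \<and> smooth_on (definite_on U\<^sub>A) \<phi> \<and> smooth_on ?T' \<psi> \<and>
        \<phi> ` (?N \<inter> definite_on U\<^sub>A) = ?E \<inter> ?T'"
      using frame_in_definite_on[OF UA(1,2)] UA(3) smooth_on_open[OF open_definite_on \<phi>]
        smooth_on_open[OF open_definite_on \<psi>] open_definite_on by blast
    show ?thesis
      by (rule exI[of _ "definite_on U\<^sub>A"], rule exI[of _ ?T'], rule exI[of _ \<phi>], rule exI[of _ \<psi>]) (rule chart)
  qed
  ultimately show ?thesis unfolding embedded_submanifold_def by blast
qed

section \<open>Tangent spaces\<close>

lemmas has_vector_derivative_matrix_mult =
  bounded_bilinear.has_vector_derivative[OF bounded_bilinear_matrix_mult]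
lemmas has_vector_derivative_transpose =
  bounded_linear.has_vector_derivative[OF bounded_linear_transpose]
lemmas has_vector_derivative_fst = bounded_linear.has_vector_derivative[OF bounded_linear_fst]
lemmas has_vector_derivative_snd = bounded_linear.has_vector_derivative[OF bounded_linear_snd]

lemma vector_derivative_eq_if_eventually_eq:
  assumes "(f has_vector_derivative v) (at 0)" "(g has_vector_derivative w) (at 0)"
    and "\<forall>\<^sub>F t in nhds 0. f t = g t"
  shows "v = w"
  using has_vector_derivative_eventually_cong[OF assms(1,3)] assms(2) by (rule vector_derivative_unique_at)

lemma Ck_on_has_vector_derivative:
  assumes "\<And>k. Ck_on k S f" "t \<in> S"
  shows "\<exists>w. (f has_vector_derivative w) (at t)"
proof -
  have "Ck_on (Suc 0) S f" by (rule assms(1))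
  then obtain f' where f': "(f has_derivative f') (at t)"
    using assms(2) unfolding Ck_on.simps(2) by blast
  have "f' s = s *\<^sub>R f' 1" for s
    using linear_scale[OF has_derivative_linear[OF f'], of s 1] by simp
  then have "f' = (\<lambda>s. s *\<^sub>R f' 1)" by blast
  with f' have "(f has_vector_derivative f' 1) (at t)" unfolding has_vector_derivative_def by simp
  then show ?thesis ..
qed

lemma Ck_on_Pair:
  assumes "Ck_on k S f" "Ck_on k S g"
  shows "Ck_on k S (\<lambda>x. (f x, g x))"
proof -
  have "Ck_on k S (\<lambda>x. (f x, 0) + (0, g x))"
    using Ck_on_compose[OF Ck_on_linear[OF bounded_linear_Pair[OF bounded_linear_ident bounded_linear_zero]], of k S f UNIV]
      Ck_on_compose[OF Ck_on_linear[OF bounded_linear_Pair[OF bounded_linear_zero bounded_linear_ident]], of k S g UNIV]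
      assms by (intro Ck_on_add) auto
  then show ?thesis by simp
qed

text \<open>The Cayley transform of a skew matrix gives a rational curve of orthogonal matrices.\<close>

lemma orthogonal_curve_exists:
  fixes X :: "real ^ 'n ^ 'n"
  assumes skew: "transpose X = - X"
  obtains Q where "Q 0 = mat 1" "\<And>t :: real. orthogonal_matrix (Q t)" "\<And>k. Ck_on k UNIV Q"
    "(Q has_vector_derivative X) (at 0)"
proof -
  define P where "P t = mat 1 - (t / 2) *\<^sub>R X" for t :: real
  define N where "N t = mat 1 + (t / 2) *\<^sub>R X" for t :: real
  define Q where "Q t = matrix_inv (P t) ** N t" for t
  have "x \<bullet> (X *v x) = 0" for x
  proof -
    have "x \<bullet> (X *v x) = (transpose X *v x) \<bullet> x" by (rule inner_transpose[symmetric])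
    also have "\<dots> = - (x \<bullet> (X *v x))"
      unfolding skew
      by (simp add: inner_commute matrix_vector_mult_def inner_vec_def sum_negf)
    finally show ?thesis by simp
  qed
  then have "x \<bullet> (P t *v x) = x \<bullet> x" for x t
    by (simp add: P_def matrix_vector_mult_diff_rdistrib inner_simps scaleR_matrix_vector_assoc[symmetric])
  then have "P t \<in> posdef" for t by (simp add: posdef_def)
  then have inv: "invertible (P t)" for t by (rule posdef_invertible)
  have PT: "transpose (P t) = N t" and NT: "transpose (N t) = P t" for t
    by (simp_all add: P_def N_def matrix_simps skew)
  have "N t = 2 *\<^sub>R mat 1 - P t" for t by (simp add: N_def P_def scaleR_2)
  then have comm: "N t ** P t = P t ** N t" for t by (simp add: matrix_simps)
  have iN: "invertible (N t)" for t using transpose_invertible[OF inv[of t]] by (simp add: PT)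
  have QQ: "Q t ** transpose (Q t) = mat 1" for t
  proof -
    have "Q t ** transpose (Q t) = matrix_inv (P t) ** (N t ** P t) ** matrix_inv (N t)"
      by (simp add: Q_def matrix_simps NT transpose_matrix_inv[OF inv] PT)
    also have "\<dots> = (matrix_inv (P t) ** P t) ** (N t ** matrix_inv (N t))"
      by (simp add: comm matrix_mul_assoc)
    finally show ?thesis by (simp add: matrix_inv_mult[OF inv] matrix_inv_mult[OF iN])
  qed
  have orth: "orthogonal_matrix (Q t)" for t
    using QQ[of t] by (simp add: orthogonal_matrix_def matrix_left_right_inverse)
  have scale: "bounded_linear (\<lambda>t :: real. (t / 2) *\<^sub>R X)"
    by (intro bounded_linear_scaleR_const bounded_linear_divide bounded_linear_ident)
  have CkP: "Ck_on k UNIV P" "Ck_on k UNIV N" for k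
  proof -
    show "Ck_on k UNIV N" unfolding N_def by (intro Ck_on_add Ck_on_const Ck_on_linear[OF scale])
    have "Ck_on k UNIV (\<lambda>t. mat 1 + - ((t / 2) *\<^sub>R X))"
      by (intro Ck_on_add Ck_on_const Ck_on_linear[OF bounded_linear_minus[OF scale]])
    then show "Ck_on k UNIV P" by (simp add: P_def[abs_def])
  qed
  then have smooth: "Ck_on k UNIV Q" for k
    unfolding Q_def[abs_def] by (intro Ck_on_matrix_mult Ck_on_matrix_inv_compose) (auto intro: inv)
  have Q0: "Q 0 = mat 1" by (simp add: Q_def P_def N_def matrix_inv_unique)
  obtain w where w: "(Q has_vector_derivative w) (at 0)"
    using Ck_on_has_vector_derivative[OF smooth] by blast
  have dP: "(P has_vector_derivative - (1 / 2) *\<^sub>R X) (at 0)"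
    unfolding P_def[abs_def] by (auto intro!: derivative_eq_intros)
  have dN: "(N has_vector_derivative (1 / 2) *\<^sub>R X) (at 0)"
    unfolding N_def[abs_def] by (auto intro!: derivative_eq_intros)
  have "P t ** Q t = N t" for t
    by (simp add: Q_def matrix_mul_assoc matrix_inv_mult(1)[OF inv])
  then have "P 0 ** w + (- (1 / 2) *\<^sub>R X) ** Q 0 = (1 / 2) *\<^sub>R X"
    using vector_derivative_eq_if_eventually_eq[OF has_vector_derivative_matrix_mult[OF dP w] dN] by simp
  then have "w = (1 / 2) *\<^sub>R X + (1 / 2) *\<^sub>R X"
    by (simp only: P_def Q0) (simp add: matrix_mult.minus_left diff_eq_eq)
  also have "\<dots> = X" by (simp only: scaleR_left_distrib[symmetric]) simp
  finally have "w = X" .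
  with that[OF Q0 orth smooth] w show thesis by blast
qed

lemma open_posdef_line: "open {t :: real. S + t *\<^sub>R D \<in> posdef}"
proof -
  have "open ((\<lambda>t :: real. S + t *\<^sub>R D) -` posdef)"
    by (intro open_vimage open_posdef continuous_intros)
  then show ?thesis by (simp add: vimage_def)
qed

lemma Ck_on_line: "Ck_on k T (\<lambda>t :: real. A + t *\<^sub>R B)"
  by (intro Ck_on_add Ck_on_const Ck_on_linear bounded_linear_scaleR_left)

lemma line_has_vector_derivative: "((\<lambda>t :: real. A + t *\<^sub>R B) has_vector_derivative B) (at t)"
  by (auto intro!: derivative_eq_intros)

text \<open>
  One inclusion differentiates \<open>U\<^sup>T U = 1\<close>. For the other, every tangent vector of the Stiefel manifold
  is the velocity of \<open>U\<close> under orthogonal transformations of the ambient space.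
\<close>

lemma tangent_space_stiefel_spd:
  fixes U :: "real ^ 'p ^ 'n" and S :: "real ^ 'p ^ 'p"
  assumes U: "U \<in> stiefel" and S: "S \<in> spd"
  shows "tangent_space (stiefel \<times> spd) (U, S) =
    {(\<Delta>, D). transpose U ** \<Delta> + transpose \<Delta> ** U = 0 \<and> transpose D = D}"
proof (intro set_eqI iffI; clarify)
  fix \<Delta> :: "real ^ 'p ^ 'n" and D :: "real ^ 'p ^ 'p"
  assume "(\<Delta>, D) \<in> tangent_space (stiefel \<times> spd) (U, S)"
  then obtain \<gamma> where c: "smooth_curve_at (stiefel \<times> spd) (U, S) \<gamma>"
    and v: "(\<gamma> has_vector_derivative (\<Delta>, D)) (at 0)" unfolding tangent_space_def by blast
  note sc = smooth_curve_at_eventually[OF c]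
  have f: "((\<lambda>t. fst (\<gamma> t)) has_vector_derivative \<Delta>) (at 0)"
    and g: "((\<lambda>t. snd (\<gamma> t)) has_vector_derivative D) (at 0)"
    using has_vector_derivative_fst[OF v] has_vector_derivative_snd[OF v] by simp_all
  have "transpose U ** \<Delta> + transpose \<Delta> ** U = 0"
  proof -
    have "\<forall>\<^sub>F t in nhds 0. transpose (fst (\<gamma> t)) ** fst (\<gamma> t) = mat 1"
      using sc(2) by eventually_elim (auto dest: stiefelD)
    then show ?thesis
      using vector_derivative_eq_if_eventually_eq[OF has_vector_derivative_matrix_mult[OF
            has_vector_derivative_transpose[OF f] f] has_vector_derivative_const] sc(1) by simp
  qed
  moreover have "transpose D = D"
  proof -
    have "\<forall>\<^sub>F t in nhds 0. transpose (snd (\<gamma> t)) = snd (\<gamma> t)"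
      using sc(2) by eventually_elim (auto simp: spd_iff)
    then show ?thesis
      using vector_derivative_eq_if_eventually_eq[OF has_vector_derivative_transpose[OF g] g] by simp
  qed
  ultimately show "transpose U ** \<Delta> + transpose \<Delta> ** U = 0 \<and> transpose D = D" ..
next
  fix \<Delta> :: "real ^ 'p ^ 'n" and D :: "real ^ 'p ^ 'p"
  assume "transpose U ** \<Delta> + transpose \<Delta> ** U = 0" and D: "transpose D = D"
  then have skew: "transpose \<Delta> ** U = - (transpose U ** \<Delta>)" by (simp add: eq_neg_iff_add_eq_0 add.commute)
  note eqs = stiefelD[OF U] stiefelD[OF U, THEN matrix_mult_cancel_left] skew skew[THEN matrix_mult_cancel_left]
  \<comment> \<open>A skew matrix that maps \<open>U\<close> to \<open>\<Delta>\<close>.\<close>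
  define X where "X = \<Delta> ** transpose U - U ** transpose \<Delta> - U ** transpose U ** \<Delta> ** transpose U"
  have "transpose X = - X"
    by (simp add: X_def matrix_simps eqs)
  then obtain Q where Q: "Q 0 = mat 1" "\<And>t :: real. orthogonal_matrix (Q t)" "\<And>k. Ck_on k UNIV Q"
    "(Q has_vector_derivative X) (at 0)" using orthogonal_curve_exists by metis
  have XU: "X ** U = \<Delta>" by (simp add: X_def matrix_simps eqs)
  define T where "T = {t :: real. S + t *\<^sub>R D \<in> posdef}"
  define \<gamma> where "\<gamma> t = (Q t ** U, S + t *\<^sub>R D)" for t
  have "smooth_curve_at (stiefel \<times> spd) (U, S) \<gamma>"
  proof (rule smooth_curve_atI[of _ _ T])
    show "\<gamma> 0 = (U, S)" by (simp add: \<gamma>_def Q)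
    show "open T" "0 \<in> T" using S open_posdef_line by (auto simp: T_def spd_iff)
    show "Ck_on k T \<gamma>" for k
      unfolding \<gamma>_def by (intro Ck_on_Pair Ck_on_matrix_mult Ck_on_const Ck_on_subset[OF Q(3)] Ck_on_line) auto
    have "Q t ** U \<in> stiefel" for t
    proof -
      have "transpose (Q t) ** Q t = mat 1" using Q(2)[of t] by (simp add: orthogonal_matrix_def)
      then show ?thesis by (simp add: stiefel_def matrix_simps eqs matrix_mult_cancel_left[of "transpose (Q t)"])
    qed
    then show "\<gamma> ` T \<subseteq> stiefel \<times> spd"
      using S D by (auto simp: \<gamma>_def T_def spd_iff matrix_simps)
  qed
  moreover have "(\<gamma> has_vector_derivative (\<Delta>, D)) (at 0)"
    unfolding \<gamma>_def[abs_def]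
    using has_vector_derivative_Pair[OF has_vector_derivative_matrix_mult[OF Q(4) has_vector_derivative_const]
        line_has_vector_derivative, of U S D] XU by simp
  ultimately show "(\<Delta>, D) \<in> tangent_space (stiefel \<times> spd) (U, S)"
    unfolding tangent_space_def by blast
qed

text \<open>
  The orthogonal matrix that leads from \<open>(U, S)\<close> to a point of the orbit is \<open>U\<^sup>T\<close> times the first
  component of this point. So it varies differentiably along a curve in the orbit, and its velocity is \<open>\<Omega>\<close>.
\<close>

lemma tangent_space_orbit:
  fixes U :: "real ^ 'p ^ 'n" and S :: "real ^ 'p ^ 'p"
  assumes U: "U \<in> stiefel"
  shows "tangent_space (orbit (U, S)) (U, S) = {(U ** \<Omega>, S ** \<Omega> - \<Omega> ** S) | \<Omega>. transpose \<Omega> = - \<Omega>}"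
proof (intro set_eqI iffI)
  note UU = stiefelD[OF U] stiefelD[OF U, THEN matrix_mult_cancel_left]
  {
    fix v assume "v \<in> tangent_space (orbit (U, S)) (U, S)"
    then obtain \<gamma> where c: "smooth_curve_at (orbit (U, S)) (U, S) \<gamma>"
      and v: "(\<gamma> has_vector_derivative v) (at 0)" unfolding tangent_space_def by blast
    note sc = smooth_curve_at_eventually[OF c]
    define Q where "Q t = transpose U ** fst (\<gamma> t)" for t
    have f: "((\<lambda>t. fst (\<gamma> t)) has_vector_derivative fst v) (at 0)"
      and g: "((\<lambda>t. snd (\<gamma> t)) has_vector_derivative snd v) (at 0)"
      using has_vector_derivative_fst[OF v] has_vector_derivative_snd[OF v] by simp_all
    define \<Omega> where "\<Omega> = transpose U ** fst v"
    have Q': "(Q has_vector_derivative \<Omega>) (at 0)"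
      unfolding Q_def[abs_def] \<Omega>_def
      using has_vector_derivative_matrix_mult[OF has_vector_derivative_const f, of "transpose U"] by simp
    have Q0: "Q 0 = mat 1" by (simp add: Q_def sc(1) UU)
    have ev: "\<forall>\<^sub>F t in nhds 0. transpose (Q t) ** Q t = mat 1 \<and> fst (\<gamma> t) = U ** Q t \<and>
        snd (\<gamma> t) = transpose (Q t) ** S ** Q t"
      using sc(2) by eventually_elim (auto simp: orbit_def Q_def UU orthogonal_matrix_def)
    have "transpose (Q 0) ** \<Omega> + transpose \<Omega> ** Q 0 = 0"
      by (rule vector_derivative_eq_if_eventually_eq[OF has_vector_derivative_matrix_mult[OF
            has_vector_derivative_transpose[OF Q'] Q'] has_vector_derivative_const])
         (rule eventually_mono[OF ev], simp)
    then have skew: "transpose \<Omega> = - \<Omega>" by (simp add: Q0 eq_neg_iff_add_eq_0 add.commute)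
    have "fst v = U ** \<Omega> + 0 ** Q 0"
      by (rule vector_derivative_eq_if_eventually_eq[OF f has_vector_derivative_matrix_mult[OF
            has_vector_derivative_const Q']])
         (rule eventually_mono[OF ev], simp)
    moreover have "snd v = (transpose (Q 0) ** S) ** \<Omega> + (transpose (Q 0) ** 0 + transpose \<Omega> ** S) ** Q 0"
      by (rule vector_derivative_eq_if_eventually_eq[OF g has_vector_derivative_matrix_mult[OF
            has_vector_derivative_matrix_mult[OF has_vector_derivative_transpose[OF Q']
              has_vector_derivative_const] Q']])
         (rule eventually_mono[OF ev], simp)
    ultimately have "v = (U ** \<Omega>, S ** \<Omega> - \<Omega> ** S)"
      by (simp add: prod_eq_iff Q0 skew matrix_simps)
    with skew show "v \<in> {(U ** \<Omega>, S ** \<Omega> - \<Omega> ** S) | \<Omega>. transpose \<Omega> = - \<Omega>}" by blast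
  }
  {
    fix v assume "v \<in> {(U ** \<Omega>, S ** \<Omega> - \<Omega> ** S) | \<Omega>. transpose \<Omega> = - \<Omega>}"
    then obtain \<Omega> where v: "v = (U ** \<Omega>, S ** \<Omega> - \<Omega> ** S)" and skew: "transpose \<Omega> = - \<Omega>" by blast
    obtain Q where Q: "Q 0 = mat 1" "\<And>t :: real. orthogonal_matrix (Q t)" "\<And>k. Ck_on k UNIV Q"
      "(Q has_vector_derivative \<Omega>) (at 0)" using orthogonal_curve_exists[OF skew] by metis
    define \<gamma> where "\<gamma> t = (U ** Q t, transpose (Q t) ** S ** Q t)" for t
    have "smooth_curve_at (orbit (U, S)) (U, S) \<gamma>"
    proof (rule smooth_curve_atI[of _ _ UNIV])
      show "Ck_on k UNIV \<gamma>" for k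
        unfolding \<gamma>_def by (intro Ck_on_Pair Ck_on_matrix_mult Ck_on_const Ck_on_transpose Q(3))
      show "\<gamma> ` UNIV \<subseteq> orbit (U, S)" using Q(2) by (auto simp: \<gamma>_def orbit_def)
    qed (simp_all add: \<gamma>_def Q)
    moreover have "(\<gamma> has_vector_derivative v) (at 0)"
      unfolding \<gamma>_def[abs_def] v
      using has_vector_derivative_Pair[OF
          has_vector_derivative_matrix_mult[OF has_vector_derivative_const Q(4), of U]
          has_vector_derivative_matrix_mult[OF has_vector_derivative_matrix_mult[OF
            has_vector_derivative_transpose[OF Q(4)] has_vector_derivative_const[of S]] Q(4)]]
      by (simp add: Q skew matrix_simps)
    ultimately show "v \<in> tangent_space (orbit (U, S)) (U, S)"
      unfolding tangent_space_def by blast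
  }
qed

text \<open>The product rule for \<open>U S U\<^sup>T\<close>: this is the differential of the quotient map.\<close>

definition quot_push :: "real ^ 'p ^ 'n \<Rightarrow> real ^ 'p ^ 'p \<Rightarrow>
    (real ^ 'p ^ 'n) \<times> (real ^ 'p ^ 'p) \<Rightarrow> real ^ 'n ^ 'n" where
  "quot_push U S = (\<lambda>(\<Delta>, D). \<Delta> ** S ** transpose U + U ** D ** transpose U + U ** S ** transpose \<Delta>)"

lemma quot_proj_eq: "quot_proj x = fst x ** snd x ** transpose (fst x)"
  by (simp add: quot_proj_def split_beta)

lemma differential_quot_proj:
  fixes U :: "real ^ 'p ^ 'n"
  assumes "v \<in> tangent_space M (U, S)"
  shows "differential M quot_proj (U, S) v = quot_push U S v"
proof (rule differential_eqI[OF assms])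
  fix \<gamma> assume c: "smooth_curve_at M (U, S) \<gamma>" and v: "(\<gamma> has_vector_derivative v) (at 0)"
  note sc = smooth_curve_at_eventually(1)[OF c]
  have "((\<lambda>t. fst (\<gamma> t) ** snd (\<gamma> t) ** transpose (fst (\<gamma> t))) has_vector_derivative
      (fst (\<gamma> 0) ** snd (\<gamma> 0)) ** transpose (fst v) + (fst (\<gamma> 0) ** snd v + fst v ** snd (\<gamma> 0)) ** transpose (fst (\<gamma> 0)))
      (at 0)"
    by (intro has_vector_derivative_matrix_mult has_vector_derivative_transpose
        has_vector_derivative_fst has_vector_derivative_snd v)
  then show "((quot_proj \<circ> \<gamma>) has_vector_derivative quot_push U S v) (at 0)"
    by (simp add: quot_proj_eq o_def sc quot_push_def split_beta matrix_simps ac_simps)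
qed

context
  fixes U :: "real ^ 'p ^ 'n" and W :: "real ^ 'q ^ 'n" and S :: "real ^ 'p ^ 'p"
  assumes U: "U \<in> stiefel" and W: "W \<in> stiefel" and UW: "transpose U ** W = 0"
    and q: "CARD('q) = CARD('n) - CARD('p)" and S: "S \<in> spd"
begin

lemma quot_push_horizontal_blocks:
  "transpose U ** quot_push U S (W ** B, D) ** U = D"
  "transpose W ** quot_push U S (W ** B, D) ** U = B ** S"
proof -
  note eqs = complementary_frames[OF U W UW]
  note eqs = eqs eqs[THEN matrix_mult_cancel_left]
  show "transpose U ** quot_push U S (W ** B, D) ** U = D"
    "transpose W ** quot_push U S (W ** B, D) ** U = B ** S"
    by (simp_all add: quot_push_def matrix_simps eqs)
qed

text \<open>The horizontal vector over \<open>u\<close>, as read off from the two blocks above.\<close>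

lemma quot_push_horizontal_lift:
  assumes "transpose u = u" "transpose W ** u ** W = 0"
  shows "quot_push U S (W ** (transpose W ** u ** U ** matrix_inv S), transpose U ** u ** U) = u"
proof (rule eq_if_blocks_eq[OF stiefel_resolution[OF U W UW q]])
  note eqs = complementary_frames[OF U W UW] spd_inverse(3,4)[OF S]
  note eqs = eqs eqs[THEN matrix_mult_cancel_left]
  let ?u = "quot_push U S (W ** (transpose W ** u ** U ** matrix_inv S), transpose U ** u ** U)"
  show "transpose U ** ?u ** U = transpose U ** u ** U" by (simp add: quot_push_horizontal_blocks)
  show "transpose W ** ?u ** U = transpose W ** u ** U"
    unfolding quot_push_horizontal_blocks by (simp add: matrix_simps eqs)
  show "transpose U ** ?u ** W = transpose U ** u ** W" "transpose W ** ?u ** W = transpose W ** u ** W"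
    using assms by (simp_all add: quot_push_def matrix_simps eqs spd_inverse(5)[OF S])
qed

text \<open>
  The \<open>W\<close>-block of a curve in the cone vanishes at the base point and is nonnegative nearby, so its
  velocity is 0 there. Conversely, the horizontal vector over \<open>u\<close> moves the two factors of the
  base point along lines.
\<close>

lemma tangent_space_spsd:
  "tangent_space (spsd CARD('p)) (U ** S ** transpose U) =
     {u. transpose u = u \<and> transpose W ** u ** W = 0}"
proof (intro set_eqI iffI; unfold mem_Collect_eq)
  note eqs = complementary_frames[OF U W UW]
  note eqs = eqs eqs[THEN matrix_mult_cancel_left]
  let ?A = "U ** S ** transpose U"
  {
    fix u assume "u \<in> tangent_space (spsd CARD('p)) ?A"
    then obtain \<gamma> where c: "smooth_curve_at (spsd CARD('p)) ?A \<gamma>"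
      and v: "(\<gamma> has_vector_derivative u) (at 0)" unfolding tangent_space_def by blast
    note sc = smooth_curve_at_eventually[OF c]
    have "\<forall>\<^sub>F t in nhds 0. transpose (\<gamma> t) = \<gamma> t"
      using sc(2) by eventually_elim (auto simp: spsd_def sym_mat_def)
    then have sym: "transpose u = u"
      by (rule vector_derivative_eq_if_eventually_eq[OF has_vector_derivative_transpose[OF v] v])
    have zero: "x \<bullet> ((transpose W ** u ** W) *v x) = 0" for x
    proof -
      define h where "h A = x \<bullet> ((transpose W ** A ** W) *v x)" for A :: "real ^ 'n ^ 'n"
      have h: "h A = (W *v x) \<bullet> (A *v (W *v x))" for A
        using inner_transpose[of "transpose W" x "A *v (W *v x)"]
        by (simp add: h_def matrix_vector_mul_assoc matrix_mul_assoc del: transpose_matrix_vector)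
      have "bounded_linear h"
        unfolding linear_conv_bounded_linear[symmetric] h
        by (auto intro!: linearI simp: h matrix_vector_mult_add_rdistrib inner_simps scaleR_matrix_vector_assoc[symmetric])
      then have "((\<lambda>t. h (\<gamma> t)) has_vector_derivative h u) (at 0)"
        using v by (rule bounded_linear.has_vector_derivative)
      then have d: "DERIV (\<lambda>t. h (\<gamma> t)) 0 :> h u"
        by (simp add: has_real_derivative_iff_has_vector_derivative)
      have h0: "h (\<gamma> 0) = 0" by (simp add: sc(1) h_def matrix_simps eqs)
      have "\<forall>\<^sub>F t in nhds 0. h (\<gamma> 0) \<le> h (\<gamma> t)"
        unfolding h0 using sc(2) by eventually_elim (simp add: h spsd_def)
      then obtain e where "e > 0" "\<forall>t. dist t 0 < e \<longrightarrow> h (\<gamma> 0) \<le> h (\<gamma> t)"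
        unfolding eventually_nhds_metric by blast
      then have "h u = 0"
        by (intro DERIV_local_min[OF d, of e]) (auto simp: dist_real_def abs_minus_commute)
      then show ?thesis by (simp add: h_def)
    qed
    have "(transpose W ** u ** W) *v x = 0" for x
      by (rule psd_kernel) (simp_all only: zero order_refl, simp add: matrix_simps sym)
    then have "transpose W ** u ** W = 0" by (simp add: matrix_eq)
    with sym show "transpose u = u \<and> transpose W ** u ** W = 0" ..
  }
  {
    fix u assume u: "transpose u = u \<and> transpose W ** u ** W = 0"
    define \<Delta> where "\<Delta> = W ** (transpose W ** u ** U ** matrix_inv S)"
    define D where "D = transpose U ** u ** U"
    have lift: "quot_push U S (\<Delta>, D) = u"
      using u unfolding \<Delta>_def D_def by (intro quot_push_horizontal_lift) auto
    have D: "transpose D = D" using u by (simp add: D_def matrix_simps)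
    define T where "T = {t :: real. S + t *\<^sub>R D \<in> posdef}"
    define \<gamma> where "\<gamma> t = (U + t *\<^sub>R \<Delta>) ** (S + t *\<^sub>R D) ** transpose (U + t *\<^sub>R \<Delta>)" for t :: real
    have "smooth_curve_at (spsd CARD('p)) ?A \<gamma>"
    proof (rule smooth_curve_atI[of _ _ T])
      show "\<gamma> 0 = ?A" by (simp add: \<gamma>_def)
      show "open T" "0 \<in> T" using S open_posdef_line by (auto simp: T_def spd_iff)
      show "Ck_on k T \<gamma>" for k
        unfolding \<gamma>_def by (intro Ck_on_matrix_mult Ck_on_transpose Ck_on_line)
      show "\<gamma> ` T \<subseteq> spsd CARD('p)"
      proof clarify
        fix t assume "t \<in> T"
        then have "S + t *\<^sub>R D \<in> spd" using S D by (simp add: T_def spd_iff transpose_linear)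
        moreover have "transpose U ** (U + t *\<^sub>R \<Delta>) = mat 1"
          by (simp add: \<Delta>_def matrix_simps eqs)
        ultimately show "\<gamma> t \<in> spsd CARD('p)" unfolding \<gamma>_def by (rule spsd_congruence)
      qed
    qed
    moreover have "(\<gamma> has_vector_derivative u) (at 0)"
    proof -
      have "(\<gamma> has_vector_derivative (U + 0 *\<^sub>R \<Delta>) ** (S + 0 *\<^sub>R D) ** transpose \<Delta> +
          ((U + 0 *\<^sub>R \<Delta>) ** D + \<Delta> ** (S + 0 *\<^sub>R D)) ** transpose (U + 0 *\<^sub>R \<Delta>)) (at 0)"
        unfolding \<gamma>_def[abs_def]
        by (intro has_vector_derivative_matrix_mult has_vector_derivative_transpose line_has_vector_derivative)
      then show ?thesis unfolding lift[symmetric]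
        by (simp add: quot_push_def matrix_simps ac_simps)
    qed
    ultimately show "u \<in> tangent_space (spsd CARD('p)) ?A"
      unfolding tangent_space_def by blast
  }
qed

end

section \<open>The quotient map\<close>

lemma stiefel_orthogonal:
  assumes "U \<in> stiefel" "orthogonal_matrix Q"
  shows "U ** Q \<in> stiefel"
  using stiefelD[OF assms(1), THEN matrix_mult_cancel_left, of Q] assms(2)
  by (simp add: stiefel_def orthogonal_matrix_def matrix_simps)

lemma quot_proj_image:
  "quot_proj ` ((stiefel :: (real ^ 'p ^ 'n) set) \<times> spd) = spsd CARD('p)"
proof (intro set_eqI iffI)
  fix A :: "real ^ 'n ^ 'n"
  assume "A \<in> spsd CARD('p)"
  then obtain U :: "real ^ 'p ^ 'n" and S where US: "U \<in> stiefel" "S \<in> spd" "A = U ** S ** transpose U"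
    using spsd_factorization by blast
  then have "A = quot_proj (U, S)" by (simp add: quot_proj_eq)
  with US show "A \<in> quot_proj ` ((stiefel :: (real ^ 'p ^ 'n) set) \<times> spd)" by blast
qed (auto simp: quot_proj_eq spsd_frame)

lemma smooth_on_quot_proj: "smooth_on M quot_proj"
proof -
  have "smooth_on M (\<lambda>x. fst x ** snd x ** transpose (fst x))"
    by (intro smooth_on_bilinear[OF bounded_bilinear_matrix_mult] smooth_on_linear
        bounded_linear_fst bounded_linear_snd smooth_on_linear_compose[OF bounded_linear_transpose])
  then show ?thesis by (simp add: quot_proj_eq[abs_def])
qed

text \<open>
  Two factorizations \<open>U S U\<^sup>T = V T V\<^sup>T\<close> have the same column space, so \<open>U U\<^sup>T V = V\<close>, and \<open>Q = U\<^sup>T V\<close> is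
  the orthogonal matrix that relates them.
\<close>

lemma quot_proj_fiber:
  fixes U :: "real ^ 'p ^ 'n"
  assumes U: "U \<in> stiefel" and S: "S \<in> spd"
  shows "{y \<in> stiefel \<times> spd. quot_proj y = quot_proj (U, S)} = orbit (U, S)"
proof (intro set_eqI iffI)
  fix y assume "y \<in> orbit (U, S)"
  then obtain Q where Q: "orthogonal_matrix Q" and y: "y = (U ** Q, transpose Q ** S ** Q)"
    by (auto simp: orbit_def)
  have QQ: "transpose Q ** Q = mat 1" "Q ** transpose Q = mat 1"
    using Q by (auto simp: orthogonal_matrix_def)
  have "quot_proj y = quot_proj (U, S)"
    by (simp add: y quot_proj_eq matrix_simps QQ[THEN matrix_mult_cancel_left])
  then show "y \<in> {y \<in> stiefel \<times> spd. quot_proj y = quot_proj (U, S)}"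
    using y stiefel_orthogonal[OF U Q] spd_congruence[OF S QQ(1)] by simp
next
  fix y :: "(real ^ 'p ^ 'n) \<times> (real ^ 'p ^ 'p)"
  assume "y \<in> {y \<in> stiefel \<times> spd. quot_proj y = quot_proj (U, S)}"
  then obtain V T where y: "y = (V, T)" and V: "V \<in> stiefel" and T: "T \<in> spd"
    and eq: "V ** T ** transpose V = U ** S ** transpose U"
    by (auto simp: quot_proj_eq)
  note UV = stiefelD[OF U] stiefelD[OF V] spd_inverse(3,4)[OF S] spd_inverse(3,4)[OF T]
  note eqs = UV UV[THEN matrix_mult_cancel_left]
  have "V = (V ** T ** transpose V) ** V ** matrix_inv T" by (simp add: matrix_simps eqs)
  then have "V = U ** (S ** transpose U ** V ** matrix_inv T)" unfolding eq by (simp add: matrix_simps)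
  then have UUV: "U ** (transpose U ** V) = V" by (metis UV(1) matrix_mul_assoc matrix_mul_lid)
  have "transpose (transpose U ** V) ** (transpose U ** V) = transpose V ** (U ** (transpose U ** V))"
    by (simp add: matrix_simps)
  then have "transpose (transpose U ** V) ** (transpose U ** V) = mat 1" unfolding UUV UV .
  then have "orthogonal_matrix (transpose U ** V)"
    by (simp add: orthogonal_matrix_def matrix_left_right_inverse)
  moreover have "T = transpose V ** (V ** T ** transpose V) ** V" by (simp add: matrix_simps eqs)
  then have "T = transpose (transpose U ** V) ** S ** (transpose U ** V)"
    unfolding eq by (simp add: matrix_simps)
  ultimately have "\<exists>Q. V = U ** Q \<and> T = transpose Q ** S ** Q \<and> orthogonal_matrix Q"
    using UUV by metis
  then show "y \<in> orbit (U, S)" by (simp add: orbit_def y)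
qed

context
  fixes U :: "real ^ 'p ^ 'n" and W :: "real ^ 'q ^ 'n" and S :: "real ^ 'p ^ 'p"
  assumes U: "U \<in> stiefel" and W: "W \<in> stiefel" and UW: "transpose U ** W = 0"
    and q: "CARD('q) = CARD('n) - CARD('p)" and S: "S \<in> spd"
begin

lemma horizontal_in_tangent_space:
  assumes "transpose D = D"
  shows "(W ** B, D) \<in> tangent_space (stiefel \<times> spd) (U, S)"
proof -
  note eqs = complementary_frames(3,4)[OF U W UW]
  note eqs = eqs eqs[THEN matrix_mult_cancel_left]
  show ?thesis using assms by (simp add: tangent_space_stiefel_spd[OF U S] matrix_simps eqs)
qed

lemma quot_push_in_tangent_space:
  assumes "v \<in> tangent_space (stiefel \<times> spd) (U, S)"
  shows "quot_push U S v \<in> tangent_space (spsd CARD('p)) (U ** S ** transpose U)"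
proof -
  note eqs = complementary_frames[OF U W UW]
  note eqs = eqs eqs[THEN matrix_mult_cancel_left]
  obtain \<Delta> D where v: "v = (\<Delta>, D)" "transpose D = D"
    using assms by (auto simp: tangent_space_stiefel_spd[OF U S])
  show ?thesis unfolding tangent_space_spsd[OF U W UW q S]
    using v spd_inverse(2)[OF S] by (simp add: quot_push_def matrix_simps eqs ac_simps)
qed

text \<open>Every tangent vector of the base is the image of a horizontal vector.\<close>

lemma tangent_space_spsd_cases:
  assumes "u \<in> tangent_space (spsd CARD('p)) (U ** S ** transpose U)"
  obtains B D where "transpose D = D" "u = quot_push U S (W ** B, D)"
proof
  have u: "transpose u = u" "transpose W ** u ** W = 0"
    using assms unfolding tangent_space_spsd[OF U W UW q S] by auto
  show "transpose (transpose U ** u ** U) = transpose U ** u ** U" by (simp add: matrix_simps u)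
  show "u = quot_push U S (W ** (transpose W ** u ** U ** matrix_inv S), transpose U ** u ** U)"
    using quot_push_horizontal_lift[OF U W UW q S u] by simp
qed

lemma quot_push_horizontal_inject:
  assumes "quot_push U S (W ** B, D) = quot_push U S (W ** B', D')"
  shows "B = B'" "D = D'"
proof -
  note blocks = quot_push_horizontal_blocks[OF U W UW q S]
  show "D = D'" using blocks(1)[of B D] blocks(1)[of B' D'] assms by simp
  have "B ** S ** matrix_inv S = B' ** S ** matrix_inv S"
    using blocks(2)[of B D] blocks(2)[of B' D'] assms by simp
  then show "B = B'" by (simp add: matrix_simps spd_inverse(3)[OF S])
qed

end

lemma quot_proj_submersion:
  assumes q: "CARD('q::finite) = CARD('n) - CARD('p)"
  shows "surjective_submersion ((stiefel :: (real ^ 'p ^ 'n) set) \<times> spd) (spsd CARD('p)) quot_proj"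
  unfolding surjective_submersion_def
proof (intro conjI ballI)
  show "smooth_on (stiefel \<times> spd :: ((real ^ 'p ^ 'n) \<times> (real ^ 'p ^ 'p)) set) quot_proj"
    by (rule smooth_on_quot_proj)
  show "quot_proj ` ((stiefel :: (real ^ 'p ^ 'n) set) \<times> spd) = spsd CARD('p)"
    by (rule quot_proj_image)
next
  fix x :: "(real ^ 'p ^ 'n) \<times> (real ^ 'p ^ 'p)"
  assume "x \<in> stiefel \<times> spd"
  then obtain U S where x: "x = (U, S)" and U: "U \<in> stiefel" and S: "S \<in> spd" by auto
  obtain W :: "real ^ 'q ^ 'n" where W: "W \<in> stiefel" "transpose U ** W = 0"
    using stiefel_complement[OF U q] by blast
  let ?M = "(stiefel :: (real ^ 'p ^ 'n) set) \<times> spd"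
  show "differential ?M quot_proj x ` tangent_space ?M x = tangent_space (spsd CARD('p)) (quot_proj x)"
  proof -
    have "differential ?M quot_proj (U, S) ` tangent_space ?M (U, S) =
        tangent_space (spsd CARD('p)) (U ** S ** transpose U)"
    proof (intro set_eqI iffI)
      fix u assume "u \<in> differential ?M quot_proj (U, S) ` tangent_space ?M (U, S)"
      then show "u \<in> tangent_space (spsd CARD('p)) (U ** S ** transpose U)"
        using quot_push_in_tangent_space[OF U W q S] by (auto simp: differential_quot_proj)
    next
      fix u assume "u \<in> tangent_space (spsd CARD('p)) (U ** S ** transpose U)"
      then obtain B D where BD: "transpose D = D" "u = quot_push U S (W ** B, D)"
        using tangent_space_spsd_cases[OF U W q S] by blast
      note v = horizontal_in_tangent_space[OF U W q S BD(1), of B]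
      show "u \<in> differential ?M quot_proj (U, S) ` tangent_space ?M (U, S)"
        by (rule image_eqI[OF _ v]) (simp add: BD(2) differential_quot_proj[OF v])
    qed
    then show ?thesis by (simp add: x quot_proj_eq)
  qed
qed

context
  fixes U :: "real ^ 'p ^ 'n" and W :: "real ^ 'q ^ 'n" and R :: "real ^ 'p ^ 'p"
  assumes U: "U \<in> stiefel" and W: "W \<in> stiefel" and UW: "transpose U ** W = 0"
    and q: "CARD('q) = CARD('n) - CARD('p)" and R: "R \<in> spd"
begin

text \<open>Since \<open>R\<close> is symmetric and invertible, \<open>R D\<^sub>0 R\<close> ranges over all symmetric matrices.\<close>

lemma hor_eq: "hor W R = {(W ** B, D) | B D. transpose D = D}"
proof (intro set_eqI iffI)
  note R' = spd_inverse[OF R]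
  note eqs = R'(2,3,4,5) R'(3,4)[THEN matrix_mult_cancel_left]
  fix v :: "(real ^ 'p ^ 'n) \<times> (real ^ 'p ^ 'p)"
  {
    assume "v \<in> hor W R"
    then show "v \<in> {(W ** B, D) | B D. transpose D = D}"
      by (auto simp: hor_def sym_mat_def matrix_simps eqs)
  }
  {
    assume "v \<in> {(W ** B, D) | B D. transpose D = D}"
    then obtain B D where v: "v = (W ** B, D)" and D: "transpose D = D" by blast
    have "D = R ** (matrix_inv R ** D ** matrix_inv R) ** R" by (simp add: matrix_simps eqs)
    moreover have "matrix_inv R ** D ** matrix_inv R \<in> sym_mat"
      by (simp add: sym_mat_def matrix_simps eqs D)
    ultimately show "v \<in> hor W R" unfolding hor_def v by blast
  }
qed

text \<open>
  Splitting \<open>\<Delta>\<close> by \<open>1 = W W\<^sup>T + U U\<^sup>T\<close> separates the two parts: \<open>U\<^sup>T \<Delta>\<close> is skew and belongs to the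
  vertical vector, \<open>W W\<^sup>T \<Delta>\<close> to the horizontal one.
\<close>

lemma horizontal_space_hor:
  "horizontal_space (stiefel \<times> spd) (orbit (U, R ** R)) (U, R ** R) (hor W R)"
  unfolding horizontal_space_def
proof (intro conjI)
  let ?S = "R ** R"
  note S = spd_square[OF R]
  note ST = spd_inverse(2)[OF S]
  note cf = complementary_frames[OF U W UW]
  note eqs = cf cf[THEN matrix_mult_cancel_left]
  note TM = tangent_space_stiefel_spd[OF U S]
  show "subspace (hor W R)" unfolding subspace_def
  proof (intro conjI ballI allI)
    have "(0, 0) = (W ** 0, 0 :: real ^ 'p ^ 'p)" by (simp add: matrix_simps)
    then show "0 \<in> hor W R" unfolding hor_eq zero_prod_def
      by (auto simp: transpose_linear intro!: exI[of _ 0])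
  next
    fix x y assume "x \<in> hor W R" "y \<in> hor W R"
    then show "x + y \<in> hor W R"
      unfolding hor_eq by (fastforce simp: transpose_linear matrix_mult.add_right[symmetric])
  next
    fix c x assume "x \<in> hor W R"
    then show "c *\<^sub>R x \<in> hor W R"
      unfolding hor_eq by (fastforce simp: transpose_linear matrix_mult.scaleR_right[symmetric])
  qed
  show H: "hor W R \<subseteq> tangent_space (stiefel \<times> spd) (U, ?S)"
    unfolding hor_eq using horizontal_in_tangent_space[OF U W UW q S] by blast
  show "hor W R \<inter> tangent_space (orbit (U, ?S)) (U, ?S) = {0}"
  proof (intro set_eqI iffI)
    fix v assume "v \<in> hor W R \<inter> tangent_space (orbit (U, ?S)) (U, ?S)"
    then obtain B D \<Omega> where v: "v = (W ** B, D)" "v = (U ** \<Omega>, ?S ** \<Omega> - \<Omega> ** ?S)"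
      unfolding hor_eq tangent_space_orbit[OF U] by blast
    then have "transpose U ** (U ** \<Omega>) = transpose U ** (W ** B)" by simp
    then have "\<Omega> = 0" by (simp add: eqs matrix_simps)
    then show "v \<in> {0}" using v(2) by (simp add: matrix_simps zero_prod_def)
  next
    fix v :: "(real ^ 'p ^ 'n) \<times> (real ^ 'p ^ 'p)" assume "v \<in> {0}"
    then have "v = (W ** 0, 0)" "v = (U ** 0, ?S ** 0 - 0 ** ?S)"
      by (simp_all add: matrix_simps zero_prod_def)
    moreover have "transpose (0 :: real ^ 'p ^ 'p) = 0" "transpose (0 :: real ^ 'p ^ 'p) = - 0"
      by (simp_all add: transpose_linear)
    ultimately show "v \<in> hor W R \<inter> tangent_space (orbit (U, ?S)) (U, ?S)"
      unfolding hor_eq tangent_space_orbit[OF U] by blast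
  qed
  show "tangent_space (stiefel \<times> spd) (U, ?S) =
      {h + v | h v. h \<in> hor W R \<and> v \<in> tangent_space (orbit (U, ?S)) (U, ?S)}"
  proof (intro set_eqI iffI)
    fix x assume "x \<in> tangent_space (stiefel \<times> spd) (U, ?S)"
    then obtain \<Delta> D where x: "x = (\<Delta>, D)" and sk: "transpose U ** \<Delta> + transpose \<Delta> ** U = 0"
      and D: "transpose D = D" unfolding TM by blast
    define \<Omega> where "\<Omega> = transpose U ** \<Delta>"
    have skew: "transpose \<Omega> = - \<Omega>"
      using sk by (simp add: \<Omega>_def matrix_simps eq_neg_iff_add_eq_0 add.commute)
    have "\<Delta> = W ** (transpose W ** \<Delta>) + U ** \<Omega>"
      using arg_cong[OF stiefel_resolution[OF U W UW q], of "\<lambda>X. X ** \<Delta>"]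
      by (simp add: \<Omega>_def matrix_simps add.commute)
    then have "x = (W ** (transpose W ** \<Delta>), D - (?S ** \<Omega> - \<Omega> ** ?S)) + (U ** \<Omega>, ?S ** \<Omega> - \<Omega> ** ?S)"
      by (simp add: x)
    moreover have "(W ** (transpose W ** \<Delta>), D - (?S ** \<Omega> - \<Omega> ** ?S)) \<in> hor W R"
    proof -
      have "transpose (?S ** \<Omega> - \<Omega> ** ?S) = ?S ** \<Omega> - \<Omega> ** ?S"
        by (simp only: transpose_linear matrix_transpose_mul ST[unfolded matrix_transpose_mul] skew)
           (simp add: matrix_simps)
      then show ?thesis unfolding hor_eq using D by (auto simp: transpose_linear)
    qed
    moreover have "(U ** \<Omega>, ?S ** \<Omega> - \<Omega> ** ?S) \<in> tangent_space (orbit (U, ?S)) (U, ?S)"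
      unfolding tangent_space_orbit[OF U] using skew by blast
    ultimately show "x \<in> {h + v | h v. h \<in> hor W R \<and> v \<in> tangent_space (orbit (U, ?S)) (U, ?S)}" by blast
  next
    fix x assume "x \<in> {h + v | h v. h \<in> hor W R \<and> v \<in> tangent_space (orbit (U, ?S)) (U, ?S)}"
    then obtain B D \<Omega> where x: "x = (W ** B, D) + (U ** \<Omega>, ?S ** \<Omega> - \<Omega> ** ?S)"
      and D: "transpose D = D" and skew: "transpose \<Omega> = - \<Omega>"
      unfolding hor_eq tangent_space_orbit[OF U] by blast
    show "x \<in> tangent_space (stiefel \<times> spd) (U, ?S)"
      unfolding TM x using D skew spd_inverse(2)[OF R]
      by (simp add: matrix_simps eqs)
  qed
qed

lemma differential_quot_proj_hor:
  assumes "v \<in> hor W R"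
  shows "differential (stiefel \<times> spd) quot_proj (U, R ** R) v = quot_push U (R ** R) v"
  using assms horizontal_in_tangent_space[OF U W UW q spd_square[OF R]]
  unfolding hor_eq by (blast intro: differential_quot_proj)

lemma bij_betw_differential_hor:
  "bij_betw (differential (stiefel \<times> spd) quot_proj (U, R ** R)) (hor W R)
     (tangent_space (spsd CARD('p)) (quot_proj (U, R ** R)))"
proof -
  note S = spd_square[OF R]
  have "bij_betw (quot_push U (R ** R)) (hor W R)
     (tangent_space (spsd CARD('p)) (U ** (R ** R) ** transpose U))"
    unfolding bij_betw_def
  proof (intro conjI inj_onI set_eqI iffI)
    fix x y assume xy: "x \<in> hor W R" "y \<in> hor W R" "quot_push U (R ** R) x = quot_push U (R ** R) y"
    then obtain B D B' D' where "x = (W ** B, D)" "y = (W ** B', D')" unfolding hor_eq by blast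
    then show "x = y" using quot_push_horizontal_inject[OF U W UW q S] xy(3) by metis
  next
    fix u assume "u \<in> quot_push U (R ** R) ` hor W R"
    then obtain B D where u: "u = quot_push U (R ** R) (W ** B, D)" and D: "transpose D = D"
      unfolding hor_eq by blast
    show "u \<in> tangent_space (spsd CARD('p)) (U ** (R ** R) ** transpose U)"
      unfolding u by (rule quot_push_in_tangent_space[OF U W UW q S
            horizontal_in_tangent_space[OF U W UW q S D]])
  next
    fix u assume "u \<in> tangent_space (spsd CARD('p)) (U ** (R ** R) ** transpose U)"
    then obtain B D where "transpose D = D" "u = quot_push U (R ** R) (W ** B, D)"
      using tangent_space_spsd_cases[OF U W UW q S] by blast
    then show "u \<in> quot_push U (R ** R) ` hor W R" unfolding hor_eq by blast
  qed
  then have "bij_betw (differential (stiefel \<times> spd) quot_proj (U, R ** R)) (hor W R)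
     (tangent_space (spsd CARD('p)) (U ** (R ** R) ** transpose U))"
    by (rule bij_betw_cong[THEN iffD1, rotated]) (simp add: differential_quot_proj_hor)
  moreover have "quot_proj (U, R ** R) = U ** (R ** R) ** transpose U" by (simp add: quot_proj_eq)
  ultimately show ?thesis by (simp only:)
qed

end

section \<open>The metric on the quotient\<close>

text \<open>
  The inner product of two horizontal vectors in terms of their images \<open>u\<close> and \<open>v\<close> in the tangent space
  at \<open>A\<close>. The matrix \<open>1 - A A\<^sup>\<dagger>\<close> is the projection onto the complement of the column space,
  which extracts \<open>\<Delta>\<close> from \<open>u\<close>. No factorization of \<open>A\<close> enters.
\<close>

definition spsd_metric :: "real \<Rightarrow> real ^ 'n ^ 'n \<Rightarrow> real ^ 'n ^ 'n \<Rightarrow> real ^ 'n ^ 'n \<Rightarrow> real" where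
  "spsd_metric k A u v =
     trace (pseudoinverse A ** u ** (mat 1 - A ** pseudoinverse A) ** v ** pseudoinverse A) +
     k * trace (pseudoinverse A ** u ** pseudoinverse A ** v)"

lemma trace_transpose: "trace (transpose A) = trace A"
  by (simp add: trace_def transpose_def)

lemma trace_cyclic: "trace (A ** B ** C) = trace (C ** A ** B)"
  for A :: "real ^ 'n ^ 'm" and B :: "real ^ 'k ^ 'n" and C :: "real ^ 'm ^ 'k"
  using trace_mul_sym[of "A ** B" C] by (simp add: matrix_mul_assoc)

context
  fixes U :: "real ^ 'p ^ 'n" and W :: "real ^ 'q ^ 'n" and S :: "real ^ 'p ^ 'p"
  assumes U: "U \<in> stiefel" and W: "W \<in> stiefel" and UW: "transpose U ** W = 0"
    and q: "CARD('q) = CARD('n) - CARD('p)" and S: "S \<in> spd"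
begin

lemma spsd_metric_quot_push:
  assumes D1: "transpose D1 = D1" and D2: "transpose D2 = D2"
  shows "spsd_metric k (U ** S ** transpose U) (quot_push U S (W ** B1, D1)) (quot_push U S (W ** B2, D2)) =
    trace (transpose B1 ** B2) + k * trace (matrix_inv S ** D1 ** matrix_inv S ** D2)"
proof -
  note cf = complementary_frames[OF U W UW]
  note S' = spd_inverse[OF S]
  note eqs = cf S'(3,4) cf[THEN matrix_mult_cancel_left] S'(3,4)[THEN matrix_mult_cancel_left]
  let ?P = "U ** matrix_inv S ** transpose U"
  let ?u = "quot_push U S (W ** B1, D1)" and ?v = "quot_push U S (W ** B2, D2)"
  note pinv = pseudoinverse_frame[OF U S]
  have proj: "mat 1 - U ** S ** transpose U ** ?P = W ** transpose W"
    using stiefel_resolution[OF U W UW q] by (simp add: matrix_simps eqs diff_eq_eq add.commute)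
  have "?P ** ?u ** (W ** transpose W) ** ?v ** ?P = U ** (transpose B1 ** B2) ** transpose U"
    by (simp add: quot_push_def matrix_simps eqs S'(2))
  then have 1: "trace (?P ** ?u ** (W ** transpose W) ** ?v ** ?P) = trace (transpose B1 ** B2)"
    by (simp add: trace_cyclic[of U] eqs)
  have "trace (?P ** ?u ** ?P ** ?v) = trace (U ** (matrix_inv S ** (transpose U ** ?u ** U) ** matrix_inv S) ** (transpose U ** ?v))"
    by (simp add: matrix_mul_assoc)
  also have "\<dots> = trace (matrix_inv S ** (transpose U ** ?u ** U) ** matrix_inv S ** (transpose U ** ?v ** U))"
    by (subst trace_cyclic, subst trace_mul_sym) (simp add: matrix_mul_assoc)
  also have "\<dots> = trace (matrix_inv S ** D1 ** matrix_inv S ** D2)"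
    by (simp only: quot_push_horizontal_blocks[OF U W UW q S])
  finally show ?thesis unfolding spsd_metric_def pinv proj using 1 by simp
qed

end

lemma hor_metric_eq:
  assumes R: "R \<in> spd" and W: "W \<in> stiefel"
  shows "hor_metric k R (W ** B1, D1) (W ** B2, D2) =
    trace (transpose B1 ** B2) + k * trace (matrix_inv (R ** R) ** D1 ** matrix_inv (R ** R) ** D2)"
proof -
  note R' = spd_inverse(3,4)[OF R]
  have inv: "matrix_inv (R ** R) = matrix_inv R ** matrix_inv R"
    by (rule matrix_inv_unique) (simp add: matrix_simps R' R'[THEN matrix_mult_cancel_left])
  have "trace (matrix_inv R ** D1 ** matrix_inv (R ** R) ** D2 ** matrix_inv R) =
      trace (matrix_inv R ** (matrix_inv R ** D1 ** matrix_inv (R ** R) ** D2))"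
    using trace_mul_sym[of "matrix_inv R ** D1 ** matrix_inv (R ** R) ** D2" "matrix_inv R"]
    by (simp add: matrix_mul_assoc)
  then show ?thesis
    by (simp add: hor_metric_def matrix_transpose_mul inv matrix_mul_assoc)
       (simp add: matrix_mul_assoc[symmetric] stiefelD[OF W, THEN matrix_mult_cancel_left])
qed

lemma spsd_metric_bilinear:
  "spsd_metric k A (a *\<^sub>R u + b *\<^sub>R v) w = a * spsd_metric k A u w + b * spsd_metric k A v w"
  by (simp add: spsd_metric_def matrix_simps trace_linear algebra_simps)

lemma spsd_complementary_frames_cases:
  assumes "A \<in> spsd CARD('p)" and q: "CARD('q) = CARD('n) - CARD('p)"
  obtains U :: "real ^ 'p ^ 'n" and W :: "real ^ 'q ^ 'n" and S
  where "U \<in> stiefel" "W \<in> stiefel" "transpose U ** W = 0" "S \<in> spd" "A = U ** S ** transpose U"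
  using spsd_factorization[OF assms(1)] stiefel_complement[OF _ q] by metis

lemma riemannian_metric_spsd:
  assumes q: "CARD('q::finite) = CARD('n) - CARD('p)" and k: "k > 0"
  shows "riemannian_metric (spsd CARD('p::finite) :: (real ^ 'n ^ 'n) set) (spsd_metric k)"
  unfolding riemannian_metric_def
proof (intro conjI ballI allI impI)
  fix A u v :: "real ^ 'n ^ 'n"
  assume A: "A \<in> spsd CARD('p)" and u: "u \<in> tangent_space (spsd CARD('p)) A"
    and v: "v \<in> tangent_space (spsd CARD('p)) A"
  obtain U :: "real ^ 'p ^ 'n" and W :: "real ^ 'q ^ 'n" and S where
    fr: "U \<in> stiefel" "W \<in> stiefel" "transpose U ** W = 0" "S \<in> spd" and A_eq: "A = U ** S ** transpose U"
    using spsd_complementary_frames_cases[OF A q] .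
  note frame = fr(1-3) q fr(4)
  obtain B D where u': "transpose D = D" "u = quot_push U S (W ** B, D)"
    using tangent_space_spsd_cases[OF frame] u A_eq by blast
  obtain B' D' where v': "transpose D' = D'" "v = quot_push U S (W ** B', D')"
    using tangent_space_spsd_cases[OF frame] v A_eq by blast
  have "trace (transpose B ** B') = trace (transpose B' ** B)"
    using trace_transpose[of "transpose B ** B'"] by (simp add: matrix_transpose_mul)
  moreover have "trace (matrix_inv S ** D ** matrix_inv S ** D') = trace (matrix_inv S ** D' ** matrix_inv S ** D)"
    using trace_mul_sym[of "matrix_inv S ** D" "matrix_inv S ** D'"] by (simp add: matrix_mul_assoc)
  ultimately show "spsd_metric k A u v = spsd_metric k A v u"
    unfolding A_eq u'(2) v'(2) spsd_metric_quot_push[OF frame u'(1) v'(1)]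
      spsd_metric_quot_push[OF frame v'(1) u'(1)] by simp
next
  fix A u v w :: "real ^ 'n ^ 'n" and a b
  show "spsd_metric k A (a *\<^sub>R u + b *\<^sub>R v) w = a * spsd_metric k A u w + b * spsd_metric k A v w"
    by (rule spsd_metric_bilinear)
next
  fix A u :: "real ^ 'n ^ 'n"
  assume A: "A \<in> spsd CARD('p)" and u: "u \<in> tangent_space (spsd CARD('p)) A" and "u \<noteq> 0"
  obtain U :: "real ^ 'p ^ 'n" and W :: "real ^ 'q ^ 'n" and S where
    fr: "U \<in> stiefel" "W \<in> stiefel" "transpose U ** W = 0" "S \<in> spd" and A_eq: "A = U ** S ** transpose U"
    using spsd_complementary_frames_cases[OF A q] .
  note frame = fr(1-3) q fr(4)
  obtain B D where u': "transpose D = D" "u = quot_push U S (W ** B, D)"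
    using tangent_space_spsd_cases[OF frame] u A_eq by blast
  have "\<not> (B = 0 \<and> D = 0)"
    using \<open>u \<noteq> 0\<close> u'(2) by (auto simp: quot_push_def matrix_simps)
  then have "trace (transpose B ** B) \<noteq> 0 \<or> trace (matrix_inv S ** D ** matrix_inv S ** D) \<noteq> 0"
    using trace_transpose_mult_self_eq_0(2)[of B] trace_spd_form_pos(2)[OF spd_matrix_inv[OF fr(4)] u'(1)] by blast
  moreover have "trace (transpose B ** B) \<ge> 0" "trace (matrix_inv S ** D ** matrix_inv S ** D) \<ge> 0"
    using trace_transpose_mult_self_eq_0(1)[of B] trace_spd_form_pos(1)[OF spd_matrix_inv[OF fr(4)] u'(1)] by blast+
  ultimately show "spsd_metric k A u u > 0"
    unfolding A_eq u'(2) spsd_metric_quot_push[OF frame u'(1) u'(1)] using k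
    by (metis add_nonneg_pos add_pos_nonneg less_eq_real_def mult_nonneg_nonneg mult_pos_pos)
next
  fix X Y :: "real ^ 'n ^ 'n \<Rightarrow> real ^ 'n ^ 'n"
  let ?N = "spsd CARD('p) :: (real ^ 'n ^ 'n) set"
  assume "smooth_on ?N X \<and> smooth_on ?N Y \<and>
      (\<forall>A\<in>?N. X A \<in> tangent_space ?N A \<and> Y A \<in> tangent_space ?N A)"
  then have X: "smooth_on ?N X" and Y: "smooth_on ?N Y" by auto
  note P = smooth_on_pseudoinverse[where 'p = 'p and 'n = 'n]
  note mult = smooth_on_bilinear[OF bounded_bilinear_matrix_mult]
  have "smooth_on ?N (\<lambda>A. mat 1 - A ** pseudoinverse A)"
    by (intro smooth_on_diff smooth_on_const mult smooth_on_linear[OF bounded_linear_ident] P)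
  then show "smooth_on ?N (\<lambda>A. spsd_metric k A (X A) (Y A))"
    unfolding spsd_metric_def
    by (intro smooth_on_add smooth_on_bilinear[OF bounded_bilinear_mult smooth_on_const]
        smooth_on_linear_compose[OF bounded_linear_trace] mult P X Y)
qed

section \<open>Invariance\<close>

text \<open>The Penrose equations, together with commutation, which holds because \<open>A\<close> is symmetric.\<close>

lemma spsd_pseudoinverse:
  fixes A :: "real ^ 'n ^ 'n"
  assumes "A \<in> spsd CARD('p::finite)"
  shows "transpose A = A" "transpose (pseudoinverse A) = pseudoinverse A"
    "A ** pseudoinverse A = pseudoinverse A ** A"
    "A ** pseudoinverse A ** A = A" "pseudoinverse A ** A ** pseudoinverse A = pseudoinverse A"
    "pseudoinverse A \<in> spsd CARD('p)" "pseudoinverse (pseudoinverse A) = A"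
proof -
  obtain U :: "real ^ 'p ^ 'n" and S where U: "U \<in> stiefel" and S: "S \<in> spd" and A: "A = U ** S ** transpose U"
    using spsd_factorization[OF assms] by blast
  note S' = spd_inverse[OF S]
  note base = stiefelD[OF U] S'(3,4)
  note eqs = base base[THEN matrix_mult_cancel_left] S'(2,5)
  have P: "pseudoinverse A = U ** matrix_inv S ** transpose U"
    unfolding A by (rule pseudoinverse_frame[OF U S])
  show "transpose A = A" "transpose (pseudoinverse A) = pseudoinverse A"
    "A ** pseudoinverse A = pseudoinverse A ** A"
    "A ** pseudoinverse A ** A = A" "pseudoinverse A ** A ** pseudoinverse A = pseudoinverse A"
    unfolding P by (simp_all add: A matrix_simps eqs)
  show "pseudoinverse A \<in> spsd CARD('p)" unfolding P by (rule spsd_frame[OF U spd_matrix_inv[OF S]])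
  have "matrix_inv (matrix_inv S) = S" by (rule matrix_inv_unique) (rule S'(4))
  then show "pseudoinverse (pseudoinverse A) = A"
    unfolding P pseudoinverse_frame[OF U spd_matrix_inv[OF S]] by (simp add: A)
qed

lemma differential_linear:
  assumes "bounded_linear f" "v \<in> tangent_space M x"
  shows "differential M f x v = f v"
  using assms by (intro differential_eqI) (auto simp: o_def intro: bounded_linear.has_vector_derivative)

lemma metric_invariant_orthogonal_conj:
  fixes Q :: "real ^ 'n ^ 'n"
  assumes Q: "orthogonal_matrix Q"
  shows "metric_invariant (spsd CARD('p::finite)) (spsd_metric k) (\<lambda>A. Q ** A ** transpose Q)"
  unfolding metric_invariant_def
proof (intro conjI ballI)
  let ?f = "\<lambda>A. Q ** A ** transpose Q"
  let ?N = "spsd CARD('p) :: (real ^ 'n ^ 'n) set"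
  have lin: "bounded_linear ?f"
    by (intro bounded_linear_compose[OF matrix_mult.bounded_linear_left matrix_mult.bounded_linear_right])
  show "smooth_on ?N ?f" by (rule smooth_on_linear[OF lin])
  show "?f ` ?N \<subseteq> ?N" using spsd_orthogonal_conj[OF _ Q] by blast
  fix A u v assume A: "A \<in> ?N" and u: "u \<in> tangent_space ?N A" and v: "v \<in> tangent_space ?N A"
  note A' = spsd_pseudoinverse[OF A]
  have QQ: "transpose Q ** Q = mat 1" "Q ** transpose Q = mat 1" using Q by (auto simp: orthogonal_matrix_def)
  note eqs = QQ QQ[THEN matrix_mult_cancel_left]
  let ?P = "pseudoinverse A"
  have mult: "?f X ** ?f Y = ?f (X ** Y)" for X Y by (simp add: matrix_simps eqs)
  have transpose_f: "transpose (?f X) = ?f (transpose X)" for X by (simp add: matrix_simps)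
  have "transpose (A ** ?P) = A ** ?P" "transpose (?P ** A) = ?P ** A"
    by (simp_all only: matrix_transpose_mul A'(1-3))
  then have P: "pseudoinverse (?f A) = ?f ?P"
    by (intro pseudoinverse_eqI) (simp_all only: mult transpose_f A'(4,5))
  have tr: "trace (?f X) = trace X" for X by (simp add: trace_cyclic[of Q] eqs)
  have 1: "mat 1 - ?f (A ** ?P) = ?f (mat 1 - A ** ?P)" by (simp add: matrix_simps eqs)
  show "spsd_metric k (?f A) (differential ?N ?f A u) (differential ?N ?f A v) = spsd_metric k A u v"
    unfolding differential_linear[OF lin u] differential_linear[OF lin v] spsd_metric_def P mult 1 tr ..
qed

lemma metric_invariant_scaling:
  assumes \<mu>: "\<mu> \<noteq> 0"
  shows "metric_invariant (spsd CARD('p::finite) :: (real ^ 'n ^ 'n) set) (spsd_metric k) (\<lambda>A. \<mu>\<^sup>2 *\<^sub>R A)"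
  unfolding metric_invariant_def
proof (intro conjI ballI)
  let ?f = "\<lambda>A :: real ^ 'n ^ 'n. \<mu>\<^sup>2 *\<^sub>R A"
  let ?N = "spsd CARD('p) :: (real ^ 'n ^ 'n) set"
  have lin: "bounded_linear ?f" by (rule bounded_linear_scaleR_right)
  show "smooth_on ?N ?f" by (rule smooth_on_linear[OF lin])
  show "?f ` ?N \<subseteq> ?N"
  proof clarify
    fix A :: "real ^ 'n ^ 'n" assume "A \<in> ?N"
    then obtain U :: "real ^ 'p ^ 'n" and S where US: "U \<in> stiefel" "S \<in> spd" and A: "A = U ** S ** transpose U"
      using spsd_factorization by blast
    have "U ** (\<mu>\<^sup>2 *\<^sub>R S) ** transpose U \<in> ?N" using US \<mu> by (intro spsd_frame spd_scaleR) auto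
    then show "?f A \<in> ?N" by (simp add: A matrix_simps)
  qed
  fix A u v assume A: "A \<in> ?N" and u: "u \<in> tangent_space ?N A" and v: "v \<in> tangent_space ?N A"
  note A' = spsd_pseudoinverse[OF A]
  have P: "pseudoinverse (?f A) = (1 / \<mu>\<^sup>2) *\<^sub>R pseudoinverse A"
    using A'(4,5) \<mu> by (intro pseudoinverse_eqI) (simp_all add: matrix_simps A'(1-3))
  show "spsd_metric k (?f A) (differential ?N ?f A u) (differential ?N ?f A v) = spsd_metric k A u v"
    unfolding differential_linear[OF lin u] differential_linear[OF lin v] spsd_metric_def P
    using \<mu> by (simp add: matrix_mult.scaleR_left matrix_mult.scaleR_right trace_linear)
qed

text \<open>
  Differentiating \<open>X A X = X\<close>, \<open>A X X = X\<close> and \<open>X X A = X\<close> along a curve, where \<open>X\<close> is the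
  pseudoinverse of \<open>A\<close>, determines the blocks of its velocity with respect to the column space
  of \<open>A\<close>. They are those of the velocity of \<open>A\<close>, up to sign and multiplication by \<open>X\<close>.
\<close>

lemma differential_pseudoinverse_blocks:
  fixes A :: "real ^ 'n ^ 'n"
  assumes A: "A \<in> spsd CARD('p::finite)" and u: "u \<in> tangent_space (spsd CARD('p)) A"
  defines "w \<equiv> differential (spsd CARD('p)) pseudoinverse A u"
    and "X \<equiv> pseudoinverse A" and "E \<equiv> mat 1 - pseudoinverse A ** A"
  shows "A ** w ** A = - (A ** X ** u ** X ** A)" "E ** w ** A = E ** u ** X" "A ** w ** E = X ** u ** E"
proof -
  let ?N = "spsd CARD('p) :: (real ^ 'n ^ 'n) set"
  obtain \<gamma> where c: "smooth_curve_at ?N A \<gamma>" and g: "(\<gamma> has_vector_derivative u) (at 0)"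
    and h: "((\<lambda>t. pseudoinverse (\<gamma> t)) has_vector_derivative w) (at 0)"
    using smooth_on_differential[OF smooth_on_pseudoinverse A u] unfolding w_def o_def by blast
  note sc = smooth_curve_at_eventually[OF c]
  note A' = spsd_pseudoinverse[OF A, folded X_def]
  have ev: "\<forall>\<^sub>F t in nhds 0. pseudoinverse (\<gamma> t) ** \<gamma> t ** pseudoinverse (\<gamma> t) = pseudoinverse (\<gamma> t) \<and>
      \<gamma> t ** pseudoinverse (\<gamma> t) = pseudoinverse (\<gamma> t) ** \<gamma> t"
    using sc(2) by eventually_elim (blast intro: spsd_pseudoinverse)
  have 1: "(X ** A) ** w + (X ** u + w ** A) ** X = w"
    unfolding X_def using vector_derivative_eq_if_eventually_eq[OF has_vector_derivative_matrix_mult[OF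
          has_vector_derivative_matrix_mult[OF h g] h] h eventually_mono[OF ev]] by (simp add: sc(1))
  have 2: "(A ** X) ** w + (A ** w + u ** X) ** X = w"
    unfolding X_def using vector_derivative_eq_if_eventually_eq[OF has_vector_derivative_matrix_mult[OF
          has_vector_derivative_matrix_mult[OF g h] h] h eventually_mono[OF ev]] by (simp add: sc(1))
  have ev': "\<forall>\<^sub>F t in nhds 0. pseudoinverse (\<gamma> t) ** pseudoinverse (\<gamma> t) ** \<gamma> t = pseudoinverse (\<gamma> t)"
    using ev by (rule eventually_mono) (metis matrix_mul_assoc)
  have 3: "(X ** X) ** u + (X ** w + w ** X) ** A = w"
    unfolding X_def using vector_derivative_eq_if_eventually_eq[OF has_vector_derivative_matrix_mult[OF
          has_vector_derivative_matrix_mult[OF h h] g] h ev'] by (simp add: sc(1))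
  have AX: "A ** X = X ** A" by (rule A'(3))
  have a: "A ** (X ** A) = A" "X ** (A ** X) = X" "X ** (X ** A) = X" "X ** (A ** A) = A"
    using A'(4,5) AX by (metis matrix_mul_assoc)+
  note a = a a[THEN matrix_mult_cancel_left]
  have a': "A ** (X ** (A ** Y)) = A ** Y" "X ** (A ** (X ** Y)) = X ** Y"
    "X ** (X ** (A ** Y)) = X ** Y" "X ** (A ** (A ** Y)) = A ** Y" "A ** (X ** Y) = X ** (A ** Y)"
    for Y :: "real ^ 'k ^ 'n"
    using a(1-4) AX by (metis matrix_mul_assoc)+
  show "A ** w ** A = - (A ** X ** u ** X ** A)"
    using arg_cong[OF 1, of "\<lambda>Y. A ** Y ** A"]
    by (simp add: matrix_simps a a' AX eq_neg_iff_add_eq_0)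
  show "E ** w ** A = E ** u ** X"
    using arg_cong[OF 2, of "\<lambda>Y. E ** Y ** A"]
    by (simp add: E_def X_def[symmetric] matrix_simps a a' AX)
  show "A ** w ** E = X ** u ** E"
    using arg_cong[OF 3, of "\<lambda>Y. A ** Y ** E"]
    by (simp add: E_def X_def[symmetric] matrix_simps a a' AX)
qed

text \<open>
  In the first term of the metric the mixed blocks of \<open>u\<close> and of its image agree once they are multiplied by
  the respective pseudoinverse. In the second term the sign of the diagonal block occurs twice.
\<close>

lemma metric_invariant_pseudoinverse:
  "metric_invariant (spsd CARD('p::finite) :: (real ^ 'n ^ 'n) set) (spsd_metric k) pseudoinverse"
  unfolding metric_invariant_def
proof (intro conjI ballI smooth_on_pseudoinverse)
  let ?N = "spsd CARD('p) :: (real ^ 'n ^ 'n) set"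
  show "pseudoinverse ` ?N \<subseteq> ?N" using spsd_pseudoinverse(6)[where 'p = 'p] by blast
  fix A u v assume A: "A \<in> ?N" and u: "u \<in> tangent_space ?N A" and v: "v \<in> tangent_space ?N A"
  define X where "X = pseudoinverse A"
  define E where "E = mat 1 - X ** A"
  note A' = spsd_pseudoinverse[OF A, folded X_def]
  define u' where "u' = differential ?N pseudoinverse A u"
  define v' where "v' = differential ?N pseudoinverse A v"
  note bu = differential_pseudoinverse_blocks[OF A u, folded X_def, folded E_def u'_def]
  note bv = differential_pseudoinverse_blocks[OF A v, folded X_def, folded E_def v'_def]
  have AXA: "A ** (X ** A) = A" "X ** (A ** X) = X" using A'(4,5) by (simp_all add: matrix_mul_assoc)
  have EE: "E ** E = E" unfolding E_def by (simp add: matrix_simps AXA)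
  have "A ** u' ** E ** v' ** A = (A ** u' ** E) ** (E ** v' ** A)"
    by (simp add: matrix_mul_assoc[symmetric] EE[THEN matrix_mult_cancel_left])
  also have "\<dots> = X ** u ** E ** v ** X"
    unfolding bu bv by (simp add: matrix_mul_assoc[symmetric] EE[THEN matrix_mult_cancel_left])
  finally have 1: "A ** u' ** E ** v' ** A = X ** u ** E ** v ** X" .
  have "trace (A ** u' ** A ** v') = trace ((A ** u' ** A) ** (X ** (A ** v' ** A) ** X))"
  proof -
    have "(A ** u' ** A) ** (X ** (A ** v' ** A) ** X) = (A ** u' ** (A ** (X ** A)) ** v') ** (A ** X)"
      by (simp add: matrix_mul_assoc)
    also have "trace \<dots> = trace ((X ** A) ** (A ** u' ** A ** v'))"
      unfolding AXA A'(3) by (rule trace_mul_sym)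
    also have "(X ** A) ** (A ** u' ** A ** v') = (A ** X ** A) ** (u' ** A ** v')"
      unfolding A'(3) by (simp add: matrix_mul_assoc)
    also have "\<dots> = A ** u' ** A ** v'" unfolding A'(4) by (simp add: matrix_mul_assoc)
    finally show ?thesis ..
  qed
  also have "(A ** u' ** A) ** (X ** (A ** v' ** A) ** X) =
      (A ** X) ** u ** (X ** A ** X) ** (A ** X) ** v ** (X ** A ** X)"
    unfolding bu bv by (simp add: matrix_simps)
  also have "trace \<dots> = trace (X ** u ** X ** v)"
  proof -
    have "(X ** A ** X) ** (A ** X) = X" using A'(5) by (simp add: matrix_mul_assoc)
    then have "(A ** X) ** u ** (X ** A ** X) ** (A ** X) ** v ** (X ** A ** X) = (A ** X) ** (u ** X ** v ** X)"
      unfolding A'(5) by (metis matrix_mul_assoc)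
    also have "trace \<dots> = trace ((u ** X ** v ** X) ** (A ** X))" by (rule trace_mul_sym)
    also have "(u ** X ** v ** X) ** (A ** X) = (u ** X ** v) ** X"
      using A'(5) by (metis matrix_mul_assoc)
    also have "trace \<dots> = trace (X ** (u ** X ** v))" by (rule trace_mul_sym)
    finally show ?thesis by (simp add: matrix_mul_assoc)
  qed
  finally have 2: "trace (A ** u' ** A ** v') = trace (X ** u ** X ** v)" .
  show "spsd_metric k (pseudoinverse A) (differential ?N pseudoinverse A u) (differential ?N pseudoinverse A v) =
      spsd_metric k A u v"
    unfolding spsd_metric_def u'_def[symmetric] v'_def[symmetric] X_def[symmetric] A'(7)
      A'(3) E_def[symmetric] 1 2 ..
qed

theorem theorem1:
  fixes k :: real
    and M :: "((real ^ 'p::finite ^ 'n::finite) \<times> (real ^ 'p ^ 'p)) set"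
    and N :: "(real ^ 'n ^ 'n) set"
  assumes "1 \<le> CARD('p)" and "CARD('p) < CARD('n)" and "CARD('q::finite) = CARD('n) - CARD('p)"
    and "k > 0"
  defines "M \<equiv> stiefel \<times> spd" and "N \<equiv> spsd CARD('p)"
  shows
    "surjective_submersion M N quot_proj \<and>
     (\<forall>x\<in>M. {y \<in> M. quot_proj y = quot_proj x} = orbit x) \<and>
     (\<forall>U\<in>stiefel. \<forall>R\<in>spd. \<forall>W :: real ^ 'q ^ 'n.
        W \<in> stiefel \<and> transpose U ** W = 0 \<longrightarrow>
        horizontal_space M (orbit (U, R ** R)) (U, R ** R) (hor W R) \<and>
        bij_betw (differential M quot_proj (U, R ** R)) (hor W R)
          (tangent_space N (quot_proj (U, R ** R)))) \<and>
     (\<exists>G. riemannian_manifold N G \<and>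
        (\<forall>U\<in>stiefel. \<forall>R\<in>spd. \<forall>W :: real ^ 'q ^ 'n.
           W \<in> stiefel \<and> transpose U ** W = 0 \<longrightarrow>
           (\<forall>\<xi>\<in>hor W R. \<forall>\<eta>\<in>hor W R.
              G (quot_proj (U, R ** R))
                (differential M quot_proj (U, R ** R) \<xi>)
                (differential M quot_proj (U, R ** R) \<eta>) = hor_metric k R \<xi> \<eta>)) \<and>
        (\<forall>Q. orthogonal_matrix Q \<longrightarrow> metric_invariant N G (\<lambda>A. Q ** A ** transpose Q)) \<and>
        (\<forall>\<mu>. \<mu> \<noteq> 0 \<longrightarrow> metric_invariant N G (\<lambda>A. \<mu>\<^sup>2 *\<^sub>R A)) \<and>
        metric_invariant N G pseudoinverse)"
proof -
  note q = assms(3)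
  have submersion: "surjective_submersion M N quot_proj"
    unfolding M_def N_def by (rule quot_proj_submersion[OF q])
  have fiber: "\<forall>x\<in>M. {y \<in> M. quot_proj y = quot_proj x} = orbit x"
    using quot_proj_fiber unfolding M_def by blast
  have horizontal: "\<forall>U\<in>stiefel. \<forall>R\<in>spd. \<forall>W :: real ^ 'q ^ 'n.
      W \<in> stiefel \<and> transpose U ** W = 0 \<longrightarrow>
      horizontal_space M (orbit (U, R ** R)) (U, R ** R) (hor W R) \<and>
      bij_betw (differential M quot_proj (U, R ** R)) (hor W R)
        (tangent_space N (quot_proj (U, R ** R)))"
    unfolding M_def N_def
    using horizontal_space_hor[OF _ _ _ q] bij_betw_differential_hor[OF _ _ _ q] by blast
  have "riemannian_manifold N (spsd_metric k)"
    unfolding riemannian_manifold_def N_def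
    using embedded_submanifold_spsd[OF q] riemannian_metric_spsd[OF q \<open>k > 0\<close>] by blast
  moreover have "spsd_metric k (quot_proj (U, R ** R)) (differential M quot_proj (U, R ** R) \<xi>)
      (differential M quot_proj (U, R ** R) \<eta>) = hor_metric k R \<xi> \<eta>"
    if U: "U \<in> stiefel" and R: "R \<in> spd" and W: "W \<in> stiefel \<and> transpose U ** W = 0"
      and \<xi>: "\<xi> \<in> hor W R" and \<eta>: "\<eta> \<in> hor W R"
    for U :: "real ^ 'p ^ 'n" and R and W :: "real ^ 'q ^ 'n" and \<xi> \<eta>
  proof -
    note frame = U conjunct1[OF W] conjunct2[OF W] q
    obtain B D where \<xi>': "transpose D = D" "\<xi> = (W ** B, D)" using \<xi> unfolding hor_eq[OF frame R] by blast
    obtain B' D' where \<eta>': "transpose D' = D'" "\<eta> = (W ** B', D')" using \<eta> unfolding hor_eq[OF frame R] by blast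
    show ?thesis
      unfolding M_def differential_quot_proj_hor[OF frame R \<xi>] differential_quot_proj_hor[OF frame R \<eta>]
      unfolding \<xi>'(2) \<eta>'(2) hor_metric_eq[OF R conjunct1[OF W]]
      using spsd_metric_quot_push[OF frame spd_square[OF R] \<xi>'(1) \<eta>'(1)] by (simp add: quot_proj_eq)
  qed
  moreover have "metric_invariant N (spsd_metric k) (\<lambda>A. Q ** A ** transpose Q)"
    if "orthogonal_matrix Q" for Q
    unfolding N_def by (rule metric_invariant_orthogonal_conj[OF that])
  moreover have "metric_invariant N (spsd_metric k) (\<lambda>A. \<mu>\<^sup>2 *\<^sub>R A)" if "\<mu> \<noteq> 0" for \<mu>
    unfolding N_def by (rule metric_invariant_scaling[OF that])
  moreover have "metric_invariant N (spsd_metric k) pseudoinverse"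
    unfolding N_def by (rule metric_invariant_pseudoinverse)
  ultimately have metric: "riemannian_manifold N (spsd_metric k) \<and>
      (\<forall>U\<in>stiefel. \<forall>R\<in>spd. \<forall>W :: real ^ 'q ^ 'n.
         W \<in> stiefel \<and> transpose U ** W = 0 \<longrightarrow>
         (\<forall>\<xi>\<in>hor W R. \<forall>\<eta>\<in>hor W R.
            spsd_metric k (quot_proj (U, R ** R))
              (differential M quot_proj (U, R ** R) \<xi>)
              (differential M quot_proj (U, R ** R) \<eta>) = hor_metric k R \<xi> \<eta>)) \<and>
      (\<forall>Q. orthogonal_matrix Q \<longrightarrow> metric_invariant N (spsd_metric k) (\<lambda>A. Q ** A ** transpose Q)) \<and>
      (\<forall>\<mu>. \<mu> \<noteq> 0 \<longrightarrow> metric_invariant N (spsd_metric k) (\<lambda>A. \<mu>\<^sup>2 *\<^sub>R A)) \<and>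
      metric_invariant N (spsd_metric k) pseudoinverse"
    by (intro conjI ballI allI impI)
  show ?thesis
    by (rule conjI[OF submersion], rule conjI[OF fiber], rule conjI[OF horizontal],
        rule exI[where x = "spsd_metric k"], rule metric)
qed

end
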